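(* Let $\Omega\subset\mathbb{C}^n$ be a bounded pseudoconvex Reinhardt domain, $1<p<\infty$, $q=p/(p-1)$, and $\lambda$ an admissible multi-radial weight on $\Omega$. If the Monomial Basis Projection $\bm{P}^{\Omega}_{p,\lambda}:L^p(\Omega,\lambda)\to A^p(\Omega,\lambda)$ exists, then for every $f\in L^p(\Omega,\lambda)$ and $z\in\Omega$, $$\bm{P}^{\Omega}_{p,\lambda}(f)(z)=\int_\Omega K^{\Omega}_{p,\lambda}(z,w)f(w)\lambda(w)\,dV(w),$$ and for each $z\in\Omega$ we have $K^{\Omega}_{p,\lambda}(z,\cdot)\in L^q(\Omega,\lambda)$.
   Context: A domain $\Omega$ is Reinhardt (centered at $0$) if $(e^{i\theta_1}z_1,\dots,e^{i\theta_n}z_n)\in\Omega$ whenever $z\in\Omega$, $\theta\in\mathbb{R}^n$. For a measurable $\lambda:\Omega\to[0,\infty]$, positive a.e., $\|f\|_{p,\lambda}^p=\int_\Omega|f|^p\lambda\,dV$ ($dV$ Lebesgue measure), $L^p(\Omega,\lambda)$ is the corresponding space and $A^p(\Omega,\lambda)=L^p(\Omega,\lambda)\cap\mathcal{O}(\Omega)$. $\lambda$ is admissible if for each compact $K\subset\Omega$ there is $C_K$ with $\sup_K|f|\le C_K\|f\|_{p,\lambda}$ for all $f\in A^p(\Omega,\lambda)$; multi-radial if $\lambda(z)$ depends only on $(|z_1|,\dots,|z_n|)$. $e_\alpha(z)=z_1^{\alpha_1}\cdots z_n^{\alpha_n}$ for $\alpha\in\mathbb{Z}^n$, $|\alpha|_\infty=\max_j|\alpha_j|$,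 $\mathcal{S}_p(\Omega,\lambda)=\{\alpha:e_\alpha\in A^p(\Omega,\lambda)\}$. Monomial Basis Kernel: $K^{\Omega}_{p,\lambda}(z,w)=\sum_{\alpha\in\mathcal{S}_p(\Omega,\lambda)}e_\alpha(z)\overline{e_\alpha(w)}|e_\alpha(w)|^{p-2}/\|e_\alpha\|_{p,\lambda}^p$. Each $f\in\mathcal{O}(\Omega)$ has a unique locally normally convergent Laurent expansion $f=\sum_\alpha c_\alpha e_\alpha$; set $a_\alpha(f)=c_\alpha$. Restricted to $A^p(\Omega,\lambda)$, $a_\alpha$ is bounded, and $\widetilde{a}_\alpha$ denotes its unique norm-preserving extension to $L^p(\Omega,\lambda)$. The Monomial Basis Projection of $A^p(\Omega,\lambda)$ (if it exists) is a bounded linear projection $\bm{P}^\Omega_{p,\lambda}$ from $L^p(\Omega,\lambda)$ onto $A^p(\Omega,\lambda)$ such that for every $f\in L^p(\Omega,\lambda)$, $\bm{P}^\Omega_{p,\lambda}f=\lim_{N\to\infty}\sum_{\alpha\in\mathcal{S}_p(\Omega,\lambda),|\alpha|_\infty\le N}\widetilde{a}_\alpha(f)e_\alpha$ in the norm of $L^p(\Omega,\lambda)$. *)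

theory Defs
  imports "HOL-Analysis.Analysis"
begin

definition cdomain :: "(complex^'n) set \<Rightarrow> bool" where
  "cdomain \<Omega> \<longleftrightarrow> open \<Omega> \<and> connected \<Omega> \<and> \<Omega> \<noteq> {}"

definition reinhardt :: "(complex^'n) set \<Rightarrow> bool" where
  "reinhardt \<Omega> \<longleftrightarrow>
     (\<forall>z\<in>\<Omega>. \<forall>\<theta>::'n \<Rightarrow> real. (\<chi> j. exp (\<i> * of_real (\<theta> j)) * z$j) \<in> \<Omega>)"

definition cont_psh :: "(complex^'n) set \<Rightarrow> (complex^'n \<Rightarrow> real) \<Rightarrow> bool" where
  "cont_psh \<Omega> u \<longleftrightarrow> continuous_on \<Omega> u \<and>
     (\<forall>a b. (\<forall>\<zeta>::complex. norm \<zeta> \<le> 1 \<longrightarrow> a + \<zeta> *s b \<in> \<Omega>) \<longrightarrow>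
        u a \<le> (1 / (2*pi)) * integral {0..2*pi} (\<lambda>t. u (a + exp (\<i> * of_real t) *s b)))"

definition pseudoconvex :: "(complex^'n) set \<Rightarrow> bool" where
  "pseudoconvex \<Omega> \<longleftrightarrow> (\<exists>\<phi>. cont_psh \<Omega> \<phi> \<and>
     (\<forall>c::real. compact (closure {z\<in>\<Omega>. \<phi> z < c}) \<and> closure {z\<in>\<Omega>. \<phi> z < c} \<subseteq> \<Omega>))"

definition holo_n :: "(complex^'n) set \<Rightarrow> (complex^'n \<Rightarrow> complex) \<Rightarrow> bool" where
  "holo_n \<Omega> f \<longleftrightarrow> (\<forall>z\<in>\<Omega>. \<exists>L. (f has_derivative L) (at z) \<and> (\<forall>c v. L (c *s v) = c * L v))"

definition wmeasure :: "(complex^'n) set \<Rightarrow> (complex^'n \<Rightarrow> ennreal) \<Rightarrow> (complex^'n) measure" where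
  "wmeasure \<Omega> wt = density lebesgue (\<lambda>z. wt z * indicator \<Omega> z)"

definition Lp_space :: "(complex^'n) set \<Rightarrow> (complex^'n \<Rightarrow> ennreal) \<Rightarrow> real \<Rightarrow> (complex^'n \<Rightarrow> complex) set" where
  "Lp_space \<Omega> wt p = {f. f \<in> borel_measurable (wmeasure \<Omega> wt) \<and>
      (\<integral>\<^sup>+ z. ennreal (norm (f z) powr p) \<partial>wmeasure \<Omega> wt) < \<infinity>}"

definition Lpnorm :: "(complex^'n) set \<Rightarrow> (complex^'n \<Rightarrow> ennreal) \<Rightarrow> real \<Rightarrow> (complex^'n \<Rightarrow> complex) \<Rightarrow> real" where
  "Lpnorm \<Omega> wt p f = enn2real (\<integral>\<^sup>+ z. ennreal (norm (f z) powr p) \<partial>wmeasure \<Omega> wt) powr (1/p)"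

definition Ap_space :: "(complex^'n) set \<Rightarrow> (complex^'n \<Rightarrow> ennreal) \<Rightarrow> real \<Rightarrow> (complex^'n \<Rightarrow> complex) set" where
  "Ap_space \<Omega> wt p = {f \<in> Lp_space \<Omega> wt p. holo_n \<Omega> f}"

definition admissible :: "(complex^'n) set \<Rightarrow> (complex^'n \<Rightarrow> ennreal) \<Rightarrow> real \<Rightarrow> bool" where
  "admissible \<Omega> wt p \<longleftrightarrow> (\<forall>K. compact K \<and> K \<subseteq> \<Omega> \<longrightarrow>
     (\<exists>C. \<forall>f\<in>Ap_space \<Omega> wt p. \<forall>z\<in>K. norm (f z) \<le> C * Lpnorm \<Omega> wt p f))"

definition multi_radial :: "(complex^'n) set \<Rightarrow> (complex^'n \<Rightarrow> ennreal) \<Rightarrow> bool" where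
  "multi_radial \<Omega> wt \<longleftrightarrow>
     (\<forall>z\<in>\<Omega>. \<forall>w\<in>\<Omega>. (\<forall>j. norm (z$j) = norm (w$j)) \<longrightarrow> wt z = wt w)"

definition monom :: "('n::finite \<Rightarrow> int) \<Rightarrow> complex^'n \<Rightarrow> complex" where
  "monom \<alpha> z = (\<Prod>j\<in>UNIV. (z$j) powi (\<alpha> j))"

definition supnorm :: "('n::finite \<Rightarrow> int) \<Rightarrow> int" where
  "supnorm \<alpha> = Max (range (\<lambda>j. \<bar>\<alpha> j\<bar>))"

definition Sp_set :: "(complex^'n::finite) set \<Rightarrow> (complex^'n \<Rightarrow> ennreal) \<Rightarrow> real \<Rightarrow> ('n \<Rightarrow> int) set" where
  "Sp_set \<Omega> wt p = {\<alpha>. monom \<alpha> \<in> Ap_space \<Omega> wt p}"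

definition laurent_series :: "(complex^'n::finite) set \<Rightarrow> (complex^'n \<Rightarrow> complex) \<Rightarrow> (('n \<Rightarrow> int) \<Rightarrow> complex) \<Rightarrow> bool" where
  "laurent_series \<Omega> f c \<longleftrightarrow>
     (\<forall>z\<in>\<Omega>. ((\<lambda>\<alpha>. c \<alpha> * monom \<alpha> z) has_sum f z) UNIV) \<and>
     (\<forall>K. compact K \<and> K \<subseteq> \<Omega> \<and> K \<noteq> {} \<longrightarrow>
        (\<lambda>\<alpha>. SUP z\<in>K. norm (c \<alpha> * monom \<alpha> z)) summable_on UNIV)"

definition laurent_coeff :: "(complex^'n::finite) set \<Rightarrow> ('n \<Rightarrow> int) \<Rightarrow> (complex^'n \<Rightarrow> complex) \<Rightarrow> complex" where
  "laurent_coeff \<Omega> \<alpha> f = (THE c. laurent_series \<Omega> f c) \<alpha>"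

definition coeff_opnorm :: "(complex^'n::finite) set \<Rightarrow> (complex^'n \<Rightarrow> ennreal) \<Rightarrow> real \<Rightarrow> ('n \<Rightarrow> int) \<Rightarrow> real" where
  "coeff_opnorm \<Omega> wt p \<alpha> = Sup ({norm (laurent_coeff \<Omega> \<alpha> f) / Lpnorm \<Omega> wt p f | f.
       f \<in> Ap_space \<Omega> wt p \<and> Lpnorm \<Omega> wt p f > 0} \<union> {0})"

text \<open>The norm-preserving (Hahn-Banach) extension of a_alpha to L^p
  (normalised to be 0 outside L^p so that it is unique as a HOL function).\<close>
definition ext_coeff :: "(complex^'n::finite) set \<Rightarrow> (complex^'n \<Rightarrow> ennreal) \<Rightarrow> real \<Rightarrow> ('n \<Rightarrow> int)
     \<Rightarrow> (complex^'n \<Rightarrow> complex) \<Rightarrow> complex" where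
  "ext_coeff \<Omega> wt p \<alpha> = (THE \<Phi>.
      (\<forall>f. f \<notin> Lp_space \<Omega> wt p \<longrightarrow> \<Phi> f = 0) \<and>
      (\<forall>f\<in>Ap_space \<Omega> wt p. \<Phi> f = laurent_coeff \<Omega> \<alpha> f) \<and>
      (\<forall>f\<in>Lp_space \<Omega> wt p. \<forall>g\<in>Lp_space \<Omega> wt p. \<Phi> (\<lambda>z. f z + g z) = \<Phi> f + \<Phi> g) \<and>
      (\<forall>f\<in>Lp_space \<Omega> wt p. \<forall>c. \<Phi> (\<lambda>z. c * f z) = c * \<Phi> f) \<and>
      (\<forall>f\<in>Lp_space \<Omega> wt p. norm (\<Phi> f) \<le> coeff_opnorm \<Omega> wt p \<alpha> * Lpnorm \<Omega> wt p f))"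

definition trunc_set :: "(complex^'n::finite) set \<Rightarrow> (complex^'n \<Rightarrow> ennreal) \<Rightarrow> real \<Rightarrow> nat \<Rightarrow> ('n \<Rightarrow> int) set" where
  "trunc_set \<Omega> wt p N = {\<alpha> \<in> Sp_set \<Omega> wt p. supnorm \<alpha> \<le> int N}"

definition is_MBP :: "(complex^'n::finite) set \<Rightarrow> (complex^'n \<Rightarrow> ennreal) \<Rightarrow> real
     \<Rightarrow> ((complex^'n \<Rightarrow> complex) \<Rightarrow> (complex^'n \<Rightarrow> complex)) \<Rightarrow> bool" where
  "is_MBP \<Omega> wt p P \<longleftrightarrow>
     (\<forall>f\<in>Lp_space \<Omega> wt p. P f \<in> Ap_space \<Omega> wt p) \<and>
     (\<forall>f\<in>Lp_space \<Omega> wt p. \<forall>g\<in>Lp_space \<Omega> wt p. \<forall>z\<in>\<Omega>. P (\<lambda>w. f w + g w) z = P f z + P g z) \<and>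
     (\<forall>f\<in>Lp_space \<Omega> wt p. \<forall>c. \<forall>z\<in>\<Omega>. P (\<lambda>w. c * f w) z = c * P f z) \<and>
     (\<exists>C. \<forall>f\<in>Lp_space \<Omega> wt p. Lpnorm \<Omega> wt p (P f) \<le> C * Lpnorm \<Omega> wt p f) \<and>
     (\<forall>g\<in>Ap_space \<Omega> wt p. \<forall>z\<in>\<Omega>. P g z = g z) \<and>
     (\<forall>f\<in>Lp_space \<Omega> wt p.
        (\<lambda>N. Lpnorm \<Omega> wt p (\<lambda>z. P f z -
            (\<Sum>\<alpha>\<in>trunc_set \<Omega> wt p N. ext_coeff \<Omega> wt p \<alpha> f * monom \<alpha> z))) \<longlonglongrightarrow> 0)"

definition mb_kernel :: "(complex^'n::finite) set \<Rightarrow> (complex^'n \<Rightarrow> ennreal) \<Rightarrow> real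
     \<Rightarrow> complex^'n \<Rightarrow> complex^'n \<Rightarrow> complex" where
  "mb_kernel \<Omega> wt p z w = lim (\<lambda>N. \<Sum>\<alpha>\<in>trunc_set \<Omega> wt p N.
      monom \<alpha> z * cnj (monom \<alpha> w) * of_real (norm (monom \<alpha> w) powr (p - 2))
        / of_real (Lpnorm \<Omega> wt p (monom \<alpha>) powr p))"

end

theory Submission
  imports Defs
begin

text \<open>
  Write \<open>\<parallel>\<cdot>\<parallel>\<close> for the norm of \<open>L\<^sup>p(\<Omega>, \<lambda>)\<close> and \<open>e\<^sub>\<alpha>\<close> for the monomials. The weighted measure is invariant under
  the torus action, so the functional \<open>\<ell>\<^sub>\<alpha>(f) = \<parallel>e\<^sub>\<alpha>\<parallel>\<^sup>-\<^sup>p \<integral> f cnj(e\<^sub>\<alpha>) \<bar>e\<^sub>\<alpha>\<bar>\<^sup>p\<^sup>-\<^sup>2 \<lambda>\<close> takes the value 1 at \<open>e\<^sub>\<alpha>\<close> and 0 at all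
  other monomials, and by Hoelder its norm is \<open>1 / \<parallel>e\<^sub>\<alpha>\<parallel>\<close>. Since every \<open>g\<close> in \<open>A\<^sup>p\<close> is fixed by the projection, it
  is a norm limit of Laurent polynomials; this identifies its Laurent coefficients with \<open>\<ell>\<^sub>\<alpha>(g)\<close>. A norm-preserving
  extension of the coefficient functional attains its norm at \<open>e\<^sub>\<alpha>\<close>, where the norm of \<open>L\<^sup>p\<close> is differentiable;
  the derivative determines the extension, which is therefore \<open>\<ell>\<^sub>\<alpha>\<close>.

  Applied to a dilate of \<open>z\<close>, admissibility gives \<open>\<bar>e\<^sub>\<alpha>(z)\<bar> \<le> C r\<^sup>\<bar>\<^sup>\<alpha>\<^sup>\<bar> \<parallel>e\<^sub>\<alpha>\<parallel>\<close> with \<open>r < 1\<close>. Since \<open>\<bar>e\<^sub>\<alpha>(z)\<bar> / \<parallel>e\<^sub>\<alpha>\<parallel>\<close> is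
  the \<open>L\<^sup>q\<close> norm of the term of index \<open>\<alpha>\<close>, the series of the kernel converges absolutely in \<open>L\<^sup>q\<close>, and it can be
  integrated against \<open>f\<close> term by term.
\<close>

section \<open>Orthogonal transformations preserve Lebesgue measure\<close>

lemma open_eq_countable_disjoint_balls_mod_null:
  fixes S :: "'a::euclidean_space set"
  assumes "open S"
  obtains C :: "('a \<times> real) set" where "countable C" "\<And>x r. (x, r) \<in> C \<Longrightarrow> 0 < r \<and> ball x r \<subseteq> S"
    "disjoint_family_on (\<lambda>(x, r). ball x r) C" "S - (\<Union>(x, r)\<in>C. ball x r) \<in> null_sets lborel"
proof -
  define K where "K = {(x, r). 0 < r \<and> ball x r \<subseteq> S}"
  have "\<exists>i. i \<in> K \<and> x \<in> ball (fst i) (snd i) \<and> snd i < d" if x: "x \<in> S" and d: "0 < d" for x d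
  proof -
    obtain r where "0 < r" "ball x r \<subseteq> S"
      using x assms by (auto simp: open_contains_ball)
    then have "(x, min r (d/2)) \<in> K"
      using d by (auto simp: K_def)
    then show ?thesis
      using d \<open>0 < r\<close> by (intro exI[of _ "(x, min r (d/2))"]) auto
  qed
  then obtain C where C: "countable C" "C \<subseteq> K"
    and disj: "pairwise (\<lambda>i j. disjnt (ball (fst i) (snd i)) (ball (fst j) (snd j))) C"
    and negl: "negligible (S - (\<Union>i\<in>C. ball (fst i) (snd i)))"
    by (rule Vitali_covering_theorem_balls[of S K fst snd])
  show thesis
  proof
    show "0 < r \<and> ball x r \<subseteq> S" if "(x, r) \<in> C" for x r
      using that C(2) by (auto simp: K_def)
    show "disjoint_family_on (\<lambda>(x, r). ball x r) C"
      using disj by (auto simp: disjoint_family_on_def pairwise_def disjnt_def split_beta)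
    have "S - (\<Union>(x, r)\<in>C. ball x r) \<in> sets borel"
      using assms by (intro sets.Diff borel_open open_UN) auto
    then show "S - (\<Union>(x, r)\<in>C. ball x r) \<in> null_sets lborel"
      using negl by (simp add: negligible_iff_null_sets null_sets_completion_iff split_beta)
  qed (rule C(1))
qed

lemma lborel_eqI_ball:
  fixes N :: "'a::euclidean_space measure"
  assumes sets_N: "sets N = sets borel"
    and balls: "\<And>x r. 0 < r \<Longrightarrow> emeasure N (ball x r) = emeasure lborel (ball x r)"
    and null: "\<And>A. A \<in> null_sets lborel \<Longrightarrow> A \<in> null_sets N"
  shows "lborel = N"
proof (rule lborel_eqI)
  fix l u :: 'a
  assume l_le_u: "\<And>b. b \<in> Basis \<Longrightarrow> l \<bullet> b \<le> u \<bullet> b"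
  obtain C where C: "countable C" "\<And>x r. (x, r) \<in> C \<Longrightarrow> 0 < r \<and> ball x r \<subseteq> box l u"
    "disjoint_family_on (\<lambda>(x, r). ball x r) C"
    and rest: "box l u - (\<Union>(x, r)\<in>C. ball x r) \<in> null_sets lborel"
    by (rule open_eq_countable_disjoint_balls_mod_null[OF open_box[of l u]]) blast
  define U where "U = (\<Union>(x, r)\<in>C. ball x r)"
  have U: "U \<in> sets borel"
    unfolding U_def by (intro borel_open open_UN) auto
  have box_eq: "box l u = U \<union> (box l u - U)"
    using C(2) by (fastforce simp: U_def)
  have "emeasure N (box l u) = emeasure N U"
    using box_eq null[OF rest] U by (metis U_def emeasure_Un_null_set sets_N)
  also have "\<dots> = (\<integral>\<^sup>+i. emeasure N (case i of (x, r) \<Rightarrow> ball x r) \<partial>count_space C)"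
    unfolding U_def by (intro emeasure_UN_countable C) (auto simp: sets_N)
  also have "\<dots> = (\<integral>\<^sup>+i. emeasure lborel (case i of (x, r) \<Rightarrow> ball x r) \<partial>count_space C)"
    using C(2) by (intro nn_integral_cong) (auto intro!: balls)
  also have "\<dots> = emeasure lborel U"
    unfolding U_def by (intro emeasure_UN_countable[symmetric] C) auto
  also have "\<dots> = emeasure lborel (box l u)"
    using box_eq rest U by (metis U_def emeasure_Un_null_set sets_lborel)
  finally show "emeasure N (box l u) = (\<Prod>b\<in>Basis. (u - l) \<bullet> b)"
    using l_le_u by (simp add: emeasure_lborel_box_eq)
qed (rule sets_N)

lemma distr_lborel_orthogonal_transformation:
  fixes T :: "'a::euclidean_space \<Rightarrow> 'a"
  assumes T: "orthogonal_transformation T"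
  shows "distr lborel borel T = lborel"
proof (rule lborel_eqI_ball[symmetric])
  have inv: "orthogonal_transformation (inv T)"
    by (rule orthogonal_transformation_inv[OF T])
  have vimage: "T -` A = inv T ` A" for A
    by (rule bij_vimage_eq_inv_image[OF orthogonal_transformation_bij[OF T]])
  have [measurable]: "T \<in> borel_measurable borel"
    using T by (intro borel_measurable_continuous_onI linear_continuous_on)
      (simp add: linear_linear orthogonal_transformation_linear)
  show "emeasure (distr lborel borel T) (ball x r) = emeasure lborel (ball x r)" if "0 < r" for x r
    using that by (simp add: emeasure_distr vimage image_orthogonal_transformation_ball[OF inv] emeasure_ball)
  fix A :: "'a set" assume A: "A \<in> null_sets lborel"
  then have "negligible (inv T ` A)"
    by (intro negligible_differentiable_image_negligible linear_imp_differentiable_on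
        orthogonal_transformation_linear inv)
      (simp_all add: negligible_iff_null_sets null_sets_completionI)
  with A show "A \<in> null_sets (distr lborel borel T)"
    using measurable_sets_borel[of T borel A]
    by (auto simp: null_sets_distr_iff vimage[symmetric] negligible_iff_null_sets null_sets_completion_iff)
qed simp

lemma
  fixes T :: "'a::euclidean_space \<Rightarrow> 'a"
  assumes T [measurable]: "T \<in> borel \<rightarrow>\<^sub>M borel" and inv: "distr lborel borel T = lborel"
  shows measurable_lebesgue_if_distr_lborel: "T \<in> lebesgue \<rightarrow>\<^sub>M lebesgue"
    and distr_lebesgue_if_distr_lborel: "distr lebesgue lebesgue T = lebesgue"
proof -
  have distr_lborel: "distr lebesgue lborel T = lborel"
    using inv by (simp add: distr_completion cong: distr_cong)
  then have null_sets_eq: "null_sets lborel = null_sets (distr lebesgue lborel T)"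
    by simp
  show "T \<in> lebesgue \<rightarrow>\<^sub>M lebesgue"
    by (simp add: completion.measurable_completion2 null_sets_eq measurable_completion)
  have "distr lebesgue lebesgue T = completion (distr lebesgue lborel T)"
    by (subst completion.completion_distr_eq) (auto simp: null_sets_eq measurable_completion)
  then show "distr lebesgue lebesgue T = lebesgue"
    by (simp add: distr_lborel)
qed

lemma distr_density_invariant:
  assumes T: "T \<in> M \<rightarrow>\<^sub>M M" and "distr M M T = M"
    and h: "h \<in> borel_measurable M" "\<And>x. h (T x) = h x"
  shows "distr (density M h) (density M h) T = density M h"
proof -
  have "distr (density M h) (density M h) T = distr (density M (\<lambda>x. h (T x))) M T"
    by (rule distr_cong) (simp_all add: h(2))
  also have "\<dots> = density (distr M M T) h"
    by (rule density_distr[symmetric]) (rule h(1), rule T)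
  finally show ?thesis by (simp add: assms(2))
qed

lemma integral_eq_0_if_equivariant:
  fixes F :: "'a \<Rightarrow> 'b::{real_normed_field, banach, second_countable_topology}"
  assumes "T \<in> M \<rightarrow>\<^sub>M M" "distr M M T = M" "F \<in> borel_measurable M"
    and "\<And>x. F (T x) = c * F x" "c \<noteq> 1"
  shows "(\<integral>x. F x \<partial>M) = 0"
proof -
  have "(\<integral>x. F x \<partial>M) = (\<integral>x. F x \<partial>distr M M T)"
    by (simp only: assms(2))
  also have "\<dots> = c * (\<integral>x. F x \<partial>M)"
    using assms(1,3) by (simp add: integral_distr assms(4))
  finally show ?thesis using \<open>c \<noteq> 1\<close> by simp
qed

section \<open>Functions with integrable \<open>p\<close>-th power\<close>

definition Lp_integrable :: "'a measure \<Rightarrow> real \<Rightarrow> ('a \<Rightarrow> 'b::real_normed_vector) \<Rightarrow> bool" where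
  "Lp_integrable M p f \<longleftrightarrow> f \<in> borel_measurable M \<and> integrable M (\<lambda>x. norm (f x) powr p)"

definition Lp_seminorm :: "'a measure \<Rightarrow> real \<Rightarrow> ('a \<Rightarrow> 'b::real_normed_vector) \<Rightarrow> real" where
  "Lp_seminorm M p f = (\<integral>x. norm (f x) powr p \<partial>M) powr (1/p)"

lemma Lp_integrable_measurable [dest]: "Lp_integrable M p f \<Longrightarrow> f \<in> borel_measurable M"
  by (simp add: Lp_integrable_def)

lemma Lp_integrable_powr: "Lp_integrable M p f \<Longrightarrow> integrable M (\<lambda>x. norm (f x) powr p)"
  by (simp add: Lp_integrable_def)

lemma Lp_integrable_bound:
  assumes g: "Lp_integrable M p g" and f: "f \<in> borel_measurable M" and p: "0 \<le> p"
    and norm_le: "AE x in M. norm (f x) \<le> norm (g x)"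
  shows "Lp_integrable M p f"
  unfolding Lp_integrable_def
proof
  show "integrable M (\<lambda>x. norm (f x) powr p)"
  proof (rule Bochner_Integration.integrable_bound[OF Lp_integrable_powr[OF g]])
    show "AE x in M. norm (norm (f x) powr p) \<le> norm (norm (g x) powr p)"
      using norm_le by eventually_elim (use p in \<open>auto intro: powr_mono2\<close>)
  qed (use f in measurable)
qed (rule f)

lemma Lp_integrable_norm: "Lp_integrable M p f \<Longrightarrow> Lp_integrable M p (\<lambda>x. norm (f x))"
  by (auto simp: Lp_integrable_def)

lemma Lp_integrable_0: "Lp_integrable M p (\<lambda>x. 0)"
  by (simp add: Lp_integrable_def)

lemma powr_add_le:
  fixes a b p :: real
  assumes "0 \<le> a" "0 \<le> b" "0 \<le> p"
  shows "(a + b) powr p \<le> 2 powr p * (a powr p + b powr p)"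
proof -
  have "(a + b) powr p \<le> (2 * max a b) powr p"
    using assms by (intro powr_mono2) auto
  also have "\<dots> = 2 powr p * max a b powr p"
    using assms by (simp add: powr_mult)
  also have "\<dots> \<le> 2 powr p * (a powr p + b powr p)"
    by (intro mult_left_mono) (auto simp: max_def)
  finally show ?thesis .
qed

lemma Lp_integrable_add:
  fixes f g :: "'a \<Rightarrow> 'b::{real_normed_vector, second_countable_topology}"
  assumes f: "Lp_integrable M p f" and g: "Lp_integrable M p g" and p: "0 \<le> p"
  shows "Lp_integrable M p (\<lambda>x. f x + g x)"
proof -
  have [measurable]: "f \<in> borel_measurable M" "g \<in> borel_measurable M"
    using f g by auto
  have "integrable M (\<lambda>x. norm (f x + g x) powr p)"
  proof (rule Bochner_Integration.integrable_bound)
    show "integrable M (\<lambda>x. 2 powr p * (norm (f x) powr p + norm (g x) powr p))"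
      using f g by (intro integrable_mult_right Bochner_Integration.integrable_add Lp_integrable_powr)
    have "norm (f x + g x) powr p \<le> 2 powr p * (norm (f x) powr p + norm (g x) powr p)" for x
      using powr_mono2[OF p norm_ge_zero norm_triangle_ineq] powr_add_le[OF norm_ge_zero norm_ge_zero p]
      by (rule order_trans)
    then show "AE x in M. norm (norm (f x + g x) powr p)
        \<le> norm (2 powr p * (norm (f x) powr p + norm (g x) powr p))"
      by simp
  qed measurable
  then show ?thesis
    by (simp add: Lp_integrable_def)
qed

lemma Lp_integrable_sum:
  fixes f :: "'i \<Rightarrow> 'a \<Rightarrow> 'b::{real_normed_vector, second_countable_topology}"
  assumes "\<And>i. i \<in> I \<Longrightarrow> Lp_integrable M p (f i)" "0 \<le> p"
  shows "Lp_integrable M p (\<lambda>x. \<Sum>i\<in>I. f i x)"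
  using assms
  by (induction I rule: infinite_finite_induct) (auto intro: Lp_integrable_add Lp_integrable_0)

lemma Lp_integrable_mult_left:
  fixes f :: "'a \<Rightarrow> 'b::{real_normed_div_algebra, second_countable_topology}"
  shows "Lp_integrable M p f \<Longrightarrow> Lp_integrable M p (\<lambda>x. c * f x)"
  by (auto simp: Lp_integrable_def norm_mult powr_mult)

lemma Lp_seminorm_nonneg [simp]: "0 \<le> Lp_seminorm M p f"
  by (simp add: Lp_seminorm_def)

lemma Lp_seminorm_powr: "0 < p \<Longrightarrow> Lp_seminorm M p f powr p = (\<integral>x. norm (f x) powr p \<partial>M)"
  by (simp add: Lp_seminorm_def powr_powr)

lemma Lp_seminorm_norm: "Lp_seminorm M p (\<lambda>x. norm (f x)) = Lp_seminorm M p f"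
  by (simp add: Lp_seminorm_def)

lemma Lp_seminorm_mult_left:
  fixes f :: "'a \<Rightarrow> 'b::real_normed_div_algebra"
  assumes "0 < p"
  shows "Lp_seminorm M p (\<lambda>x. c * f x) = norm c * Lp_seminorm M p f"
  using assms by (simp add: Lp_seminorm_def norm_mult powr_mult powr_powr)

lemma AE_eq_0_if_Lp_seminorm_eq_0:
  assumes "Lp_integrable M p f" "Lp_seminorm M p f = 0" "0 < p"
  shows "AE x in M. f x = 0"
proof -
  have "(\<integral>x. norm (f x) powr p \<partial>M) = 0"
    using Lp_seminorm_powr[OF assms(3), of M f] assms(2,3) by simp
  then have "AE x in M. norm (f x) powr p = 0"
    using integral_nonneg_eq_0_iff_AE[OF Lp_integrable_powr[OF assms(1)]] by simp
  then show ?thesis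
    by eventually_elim simp
qed

subsection \<open>The inequalities of Hoelder and Minkowski\<close>

lemma conjugate_exponent:
  fixes p q :: real
  assumes p: "1 < p" and "1/p + 1/q = 1"
  shows "1 < q" "(p - 1) * q = p"
proof -
  have "q \<noteq> 0"
    using assms by auto
  then have "(p - 1) * q = p"
    using assms by (simp add: field_simps)
  then show "(p - 1) * q = p" .
  then have "q = p / (p - 1)"
    using p by (simp add: field_simps)
  then show "1 < q"
    using p by simp
qed

lemma ex_conjugate_exponent:
  fixes p :: real
  assumes "1 < p"
  obtains q where "1/p + 1/q = 1"
proof
  show "1/p + 1/(p / (p - 1)) = 1"
    using assms by (simp add: field_simps)
qed

lemma Youngs_inequality_scaled:
  fixes a b A B p q :: real
  assumes "0 \<le> a" "0 \<le> b" and AB: "0 < A" "0 < B" and pq: "1 < p" "1/p + 1/q = 1"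
  shows "a * b \<le> A * B * (a powr p / A powr p / p + b powr q / B powr q / q)"
proof -
  have "a / A * (b / B) \<le> (a / A) powr p / p + (b / B) powr q / q"
    by (rule Youngs_inequality) (use assms conjugate_exponent[OF pq] in auto)
  then have "a * b / (A * B) \<le> a powr p / A powr p / p + b powr q / B powr q / q"
    using assms by (simp add: powr_divide)
  then show ?thesis
    using AB by (simp add: pos_divide_le_eq mult.commute)
qed

lemma Holder_integrable:
  fixes f g :: "'a \<Rightarrow> 'b::{real_normed_field, banach, second_countable_topology}"
  assumes f: "Lp_integrable M p f" and g: "Lp_integrable M q g"
    and pq: "1 < p" "1/p + 1/q = 1"
  shows "integrable M (\<lambda>x. f x * g x)"
proof (rule Bochner_Integration.integrable_bound)
  show "integrable M (\<lambda>x. norm (f x) powr p / p + norm (g x) powr q / q)"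
    using f g by (intro Bochner_Integration.integrable_add integrable_divide Lp_integrable_powr)
  have "norm (f x * g x) \<le> norm (f x) powr p / p + norm (g x) powr q / q" for x
    unfolding norm_mult by (rule Youngs_inequality) (use pq conjugate_exponent[OF pq] in auto)
  then show "AE x in M. norm (f x * g x) \<le> norm (norm (f x) powr p / p + norm (g x) powr q / q)"
    unfolding real_norm_def by (intro AE_I2 order_trans[OF _ abs_ge_self])
  show "(\<lambda>x. f x * g x) \<in> borel_measurable M"
    using Lp_integrable_measurable[OF f] Lp_integrable_measurable[OF g] by measurable
qed

lemma Holder_inequality:
  fixes f g :: "'a \<Rightarrow> 'b::{real_normed_field, banach, second_countable_topology}"
  assumes f: "Lp_integrable M p f" and g: "Lp_integrable M q g"
    and pq: "1 < p" "1/p + 1/q = 1"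
  shows "(\<integral>x. norm (f x * g x) \<partial>M) \<le> Lp_seminorm M p f * Lp_seminorm M q g"
proof -
  note q = conjugate_exponent(1)[OF pq]
  define A B where "A = Lp_seminorm M p f" and "B = Lp_seminorm M q g"
  consider (zero) "A = 0 \<or> B = 0" | (pos) "0 < A" "0 < B"
    unfolding A_def B_def by (metis Lp_seminorm_nonneg less_le)
  then show ?thesis
  proof cases
    case zero
    then have "(AE x in M. f x = 0) \<or> (AE x in M. g x = 0)"
      using AE_eq_0_if_Lp_seminorm_eq_0[OF f] AE_eq_0_if_Lp_seminorm_eq_0[OF g] pq q
      by (auto simp: A_def B_def)
    then have "AE x in M. norm (f x * g x) = 0"
      by (auto elim: eventually_mono)
    then have "(\<integral>x. norm (f x * g x) \<partial>M) = 0"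
      by (rule integral_eq_zero_AE)
    then show ?thesis
      by simp
  next
    case pos
    have "(\<integral>x. norm (f x * g x) \<partial>M)
        \<le> (\<integral>x. A * B * (norm (f x) powr p / A powr p / p + norm (g x) powr q / B powr q / q) \<partial>M)"
      unfolding norm_mult using Youngs_inequality_scaled[OF norm_ge_zero norm_ge_zero pos pq]
        integrable_norm[OF Holder_integrable[OF assms]] f g
      by (intro integral_mono integrable_mult_right Bochner_Integration.integrable_add
          integrable_divide Lp_integrable_powr) (simp_all only: norm_mult)
    also have "\<dots> = A * B * (A powr p / A powr p / p + B powr q / B powr q / q)"
      using Lp_integrable_powr[OF f] Lp_integrable_powr[OF g] pq q
      unfolding A_def B_def by (simp add: Lp_seminorm_powr)
    also have "\<dots> = A * B"
      using pos pq by simp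
    finally show ?thesis
      by (simp add: A_def B_def)
  qed
qed

lemma
  assumes f: "Lp_integrable M p f" and pq: "1 < p" "1/p + 1/q = 1"
  shows Lp_integrable_norm_powr: "Lp_integrable M q (\<lambda>x. norm (f x) powr (p - 1))"
    and Lp_seminorm_norm_powr:
      "Lp_seminorm M q (\<lambda>x. norm (f x) powr (p - 1)) = Lp_seminorm M p f powr (p - 1)"
proof -
  note q = conjugate_exponent[OF pq]
  have [measurable]: "f \<in> borel_measurable M"
    using f by auto
  show "Lp_integrable M q (\<lambda>x. norm (f x) powr (p - 1))"
    using f by (simp add: Lp_integrable_def powr_powr q)
  have "1/q = (p - 1) / p"
    using pq by (simp add: field_simps)
  then show "Lp_seminorm M q (\<lambda>x. norm (f x) powr (p - 1)) = Lp_seminorm M p f powr (p - 1)"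
    by (simp add: Lp_seminorm_def powr_powr q)
qed

lemma
  assumes f: "Lp_integrable M p f" and h: "Lp_integrable M p h" and p: "1 < p"
  shows integrable_norm_mult_powr: "integrable M (\<lambda>x. norm (f x) * norm (h x) powr (p - 1))"
    and integral_norm_mult_powr_le: "(\<integral>x. norm (f x) * norm (h x) powr (p - 1) \<partial>M)
      \<le> Lp_seminorm M p f * Lp_seminorm M p h powr (p - 1)"
proof -
  obtain q where pq: "1/p + 1/q = 1"
    by (rule ex_conjugate_exponent[OF p])
  note pairing = Lp_integrable_norm[OF f] Lp_integrable_norm_powr[OF h p pq] p pq
  show "integrable M (\<lambda>x. norm (f x) * norm (h x) powr (p - 1))"
    by (rule Holder_integrable[OF pairing])
  show "(\<integral>x. norm (f x) * norm (h x) powr (p - 1) \<partial>M) \<le> Lp_seminorm M p f * Lp_seminorm M p h powr (p - 1)"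
    using Holder_inequality[OF pairing] by (simp add: Lp_seminorm_norm Lp_seminorm_norm_powr[OF h p pq])
qed

lemma Minkowski_inequality:
  fixes f g :: "'a \<Rightarrow> 'b::{real_normed_vector, second_countable_topology}"
  assumes f: "Lp_integrable M p f" and g: "Lp_integrable M p g" and p: "1 < p"
  shows "Lp_seminorm M p (\<lambda>x. f x + g x) \<le> Lp_seminorm M p f + Lp_seminorm M p g"
proof (cases "Lp_seminorm M p (\<lambda>x. f x + g x) = 0")
  case False
  define h where "h x = f x + g x" for x
  have h: "Lp_integrable M p h"
    unfolding h_def[abs_def] using f g p by (intro Lp_integrable_add) auto
  let ?s = "Lp_seminorm M p h"
  have s: "0 < ?s"
    using False Lp_seminorm_nonneg[of M p h] unfolding h_def by linarith
  have "?s * ?s powr (p - 1) = (\<integral>x. norm (h x) * norm (h x) powr (p - 1) \<partial>M)"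
    using p Lp_seminorm_powr[of p M h] by (simp add: powr_mult_base)
  also have "\<dots> \<le> (\<integral>x. norm (f x) * norm (h x) powr (p - 1) + norm (g x) * norm (h x) powr (p - 1) \<partial>M)"
  proof (rule integral_mono)
    show "norm (h x) * norm (h x) powr (p - 1)
        \<le> norm (f x) * norm (h x) powr (p - 1) + norm (g x) * norm (h x) powr (p - 1)" for x
      unfolding distrib_right[symmetric] h_def by (intro mult_right_mono norm_triangle_ineq) simp
  qed (intro Bochner_Integration.integrable_add integrable_norm_mult_powr f g h p)+
  also have "\<dots> \<le> (Lp_seminorm M p f + Lp_seminorm M p g) * ?s powr (p - 1)"
    using integral_norm_mult_powr_le[OF f h p] integral_norm_mult_powr_le[OF g h p]
    by (simp add: integrable_norm_mult_powr f g h p distrib_right)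
  finally show ?thesis
    using s unfolding h_def[symmetric] by (simp add: mult_le_cancel_right)
qed simp

lemma Lp_seminorm_sum_le:
  fixes f :: "'i \<Rightarrow> 'a \<Rightarrow> 'b::{real_normed_vector, second_countable_topology}"
  assumes "\<And>i. i \<in> I \<Longrightarrow> Lp_integrable M p (f i)" "1 < p"
  shows "Lp_seminorm M p (\<lambda>x. \<Sum>i\<in>I. f i x) \<le> (\<Sum>i\<in>I. Lp_seminorm M p (f i))"
  using assms
proof (induction I rule: infinite_finite_induct)
  case (insert i I)
  have "Lp_seminorm M p (\<lambda>x. \<Sum>j\<in>insert i I. f j x)
      \<le> Lp_seminorm M p (f i) + Lp_seminorm M p (\<lambda>x. \<Sum>j\<in>I. f j x)"
    using insert by (simp add: Minkowski_inequality Lp_integrable_sum)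
  with insert show ?case
    by simp
qed (simp_all add: Lp_seminorm_def)

subsection \<open>Absolutely convergent series in \<open>L\<^sup>p\<close>\<close>

lemma integrable_majorant_of_incseq:
  fixes u :: "nat \<Rightarrow> 'a \<Rightarrow> real"
  assumes u: "\<And>N. integrable M (u N)" "\<And>N x. 0 \<le> u N x" "\<And>x. incseq (\<lambda>N. u N x)"
    and bound: "\<And>N. (\<integral>x. u N x \<partial>M) \<le> B"
  obtains G where "integrable M G" "AE x in M. \<forall>N. u N x \<le> G x"
proof -
  have [measurable]: "u N \<in> borel_measurable M" for N
    using u(1) by auto
  define U where "U x = (SUP N. ennreal (u N x))" for x
  have [measurable]: "U \<in> borel_measurable M"
    unfolding U_def by measurable
  have "incseq (\<lambda>N x. ennreal (u N x))"
    using incseqD[OF u(3)] by (intro monoI le_funI ennreal_leI)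
  then have "(\<integral>\<^sup>+x. U x \<partial>M) = (SUP N. \<integral>\<^sup>+x. ennreal (u N x) \<partial>M)"
    unfolding U_def by (intro nn_integral_monotone_convergence_SUP) auto
  also have "\<dots> \<le> ennreal B"
    using u(1,2) bound by (intro SUP_least) (simp add: nn_integral_eq_integral ennreal_leI)
  finally have U_finite: "(\<integral>\<^sup>+x. U x \<partial>M) < \<infinity>"
    by (rule order.strict_trans1) simp
  show thesis
  proof
    have "(\<integral>\<^sup>+x. ennreal (norm (enn2real (U x))) \<partial>M) \<le> (\<integral>\<^sup>+x. U x \<partial>M)"
      by (intro nn_integral_mono) (simp add: ennreal_enn2real_if)
    then show "integrable M (\<lambda>x. enn2real (U x))"
      using U_finite by (intro integrableI_bounded) (auto intro: order.strict_trans1)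
    have "AE x in M. U x \<noteq> \<infinity>"
      using U_finite by (intro nn_integral_PInf_AE) auto
    then show "AE x in M. \<forall>N. u N x \<le> enn2real (U x)"
    proof (eventually_elim, intro allI)
      fix x N assume "U x \<noteq> \<infinity>"
      moreover have "ennreal (u N x) \<le> U x"
        unfolding U_def by (rule SUP_upper) simp
      ultimately show "u N x \<le> enn2real (U x)"
        using enn2real_mono[of "ennreal (u N x)" "U x"] u(2)[of N x] by (simp add: less_top)
    qed
  qed
qed

lemma Lp_majorant_of_incseq:
  fixes S :: "nat \<Rightarrow> 'a \<Rightarrow> real"
  assumes p: "0 < p" and S: "\<And>N. Lp_integrable M p (S N)" "\<And>N x. 0 \<le> S N x" "\<And>x. incseq (\<lambda>N. S N x)"
    and bound: "\<And>N. Lp_seminorm M p (S N) \<le> B"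
  obtains G where "Lp_integrable M p G" "AE x in M. \<forall>N. S N x \<le> G x"
proof -
  have "integrable M (\<lambda>x. S N x powr p)" for N
    using Lp_integrable_powr[OF S(1)[of N]] S(2)[of N] by simp
  moreover have "0 \<le> S N x powr p" for N x
    by simp
  moreover have "incseq (\<lambda>N. S N x powr p)" for x
    using p S(2) incseqD[OF S(3)] by (intro monoI powr_mono2) auto
  moreover have "(\<integral>x. S N x powr p \<partial>M) \<le> B powr p" for N
  proof -
    have "(\<integral>x. S N x powr p \<partial>M) = Lp_seminorm M p (S N) powr p"
      using p S(2)[of N] by (simp add: Lp_seminorm_powr)
    also have "\<dots> \<le> B powr p"
      using p bound by (intro powr_mono2) auto
    finally show ?thesis .
  qed
  ultimately obtain G where G: "integrable M G" "AE x in M. \<forall>N. S N x powr p \<le> G x"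
    by (rule integrable_majorant_of_incseq)
  show thesis
  proof
    have "integrable M (\<lambda>x. \<bar>G x\<bar>)"
      using G(1) by simp
    then show "Lp_integrable M p (\<lambda>x. \<bar>G x\<bar> powr (1/p))"
      using p borel_measurable_integrable[OF G(1)] by (simp add: Lp_integrable_def powr_powr)
    show "AE x in M. \<forall>N. S N x \<le> \<bar>G x\<bar> powr (1/p)"
      using G(2)
    proof (eventually_elim, intro allI)
      fix x N assume "\<forall>N. S N x powr p \<le> G x"
      then have "S N x powr p \<le> \<bar>G x\<bar>"
        by (meson abs_ge_self order_trans)
      then have "(S N x powr p) powr (1/p) \<le> \<bar>G x\<bar> powr (1/p)"
        using p by (intro powr_mono2) auto
      then show "S N x \<le> \<bar>G x\<bar> powr (1/p)"
        using p S(2)[of N x] by (simp add: powr_powr)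
    qed
  qed
qed

lemma Lp_majorant_of_series:
  fixes g :: "'i \<Rightarrow> 'a \<Rightarrow> 'b::real_normed_vector"
  assumes p: "1 < p" and F: "incseq F" "\<And>N. finite (F N)"
    and g: "\<And>i N. i \<in> F N \<Longrightarrow> Lp_integrable M p (g i)"
    and bound: "\<And>N. (\<Sum>i\<in>F N. Lp_seminorm M p (g i)) \<le> B"
  obtains G :: "'a \<Rightarrow> real" where "Lp_integrable M p G" "AE x in M. \<forall>N. (\<Sum>i\<in>F N. norm (g i x)) \<le> G x"
proof -
  let ?S = "\<lambda>N x. \<Sum>i\<in>F N. norm (g i x)"
  have S: "Lp_integrable M p (?S N)" for N
    using g p by (intro Lp_integrable_sum Lp_integrable_norm) auto
  have mono: "incseq (\<lambda>N. ?S N x)" for x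
    by (intro monoI sum_mono2 F(2) incseqD[OF F(1)]) auto
  have "Lp_seminorm M p (?S N) \<le> B" for N
  proof -
    have "Lp_seminorm M p (?S N) \<le> (\<Sum>i\<in>F N. Lp_seminorm M p (\<lambda>x. norm (g i x)))"
      using g p by (intro Lp_seminorm_sum_le Lp_integrable_norm) auto
    also have "\<dots> \<le> B"
      using bound[of N] by (simp add: Lp_seminorm_norm)
    finally show ?thesis .
  qed
  then obtain G where "Lp_integrable M p G" "AE x in M. \<forall>N. ?S N x \<le> G x"
    by (rule Lp_majorant_of_incseq[of p M ?S B, rotated 4]) (use p S mono in \<open>simp_all add: sum_nonneg\<close>)
  then show thesis
    by (rule that)
qed

lemma filterlim_incseq_finite_subsets_at_top:
  assumes "incseq F" "\<And>N. finite (F N)"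
  shows "filterlim F (finite_subsets_at_top (\<Union>N. F N)) sequentially"
  unfolding filterlim_finite_subsets_at_top
proof (intro allI impI, elim conjE)
  fix X assume "finite X" "X \<subseteq> (\<Union>N. F N)"
  have "\<forall>\<^sub>F N in sequentially. x \<in> F N" if "x \<in> X" for x
  proof -
    obtain n where "x \<in> F n"
      using \<open>x \<in> X\<close> \<open>X \<subseteq> (\<Union>N. F N)\<close> by blast
    then show ?thesis
      using incseqD[OF assms(1)] by (intro eventually_sequentiallyI[of n]) blast
  qed
  then have "\<forall>\<^sub>F N in sequentially. \<forall>x\<in>X. x \<in> F N"
    by (intro eventually_ball_finite \<open>finite X\<close> ballI)
  then show "\<forall>\<^sub>F N in sequentially. finite (F N) \<and> X \<subseteq> F N \<and> F N \<subseteq> (\<Union>N. F N)"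
    by eventually_elim (use assms(2) in auto)
qed

lemma has_sum_imp_tendsto_sums_incseq:
  assumes "(f has_sum s) (\<Union>N. F N)" "incseq F" "\<And>N. finite (F N)"
  shows "(\<lambda>N. \<Sum>i\<in>F N. f i) \<longlonglongrightarrow> s"
  using assms(1) filterlim_incseq_finite_subsets_at_top[OF assms(2,3)]
  unfolding has_sum_def by (rule filterlim_compose)

lemma convergent_sums_incseq:
  fixes f :: "'i \<Rightarrow> 'b::banach"
  assumes F: "incseq F" "\<And>N. finite (F N)" and bound: "\<And>N. (\<Sum>i\<in>F N. norm (f i)) \<le> B"
  shows "convergent (\<lambda>N. \<Sum>i\<in>F N. f i)"
proof -
  have "(\<lambda>i. norm (f i)) summable_on (\<Union>N. F N)"
  proof (rule nonneg_bdd_above_summable_on)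
    show "bdd_above (sum (\<lambda>i. norm (f i)) ` {X. X \<subseteq> (\<Union>N. F N) \<and> finite X})"
    proof (rule bdd_aboveI2)
      fix X assume "X \<in> {X. X \<subseteq> (\<Union>N. F N) \<and> finite X}"
      then have "\<forall>\<^sub>F N in sequentially. finite (F N) \<and> X \<subseteq> F N \<and> F N \<subseteq> (\<Union>N. F N)"
        using filterlim_incseq_finite_subsets_at_top[OF F]
        unfolding filterlim_finite_subsets_at_top by blast
      then obtain N where "X \<subseteq> F N"
        by (auto simp: eventually_sequentially)
      then have "(\<Sum>i\<in>X. norm (f i)) \<le> (\<Sum>i\<in>F N. norm (f i))"
        by (intro sum_mono2 F(2)) auto
      then show "(\<Sum>i\<in>X. norm (f i)) \<le> B"
        using bound[of N] by simp
    qed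
  qed simp
  then obtain s where "(f has_sum s) (\<Union>N. F N)"
    using abs_summable_summable by (auto simp: summable_on_def)
  then show ?thesis
    using F by (intro convergentI has_sum_imp_tendsto_sums_incseq)
qed

lemma Lp_series_dominated:
  fixes g :: "'i \<Rightarrow> 'a \<Rightarrow> 'b::banach"
  assumes p: "1 < p" and F: "incseq F" "\<And>N. finite (F N)"
    and g: "\<And>i N. i \<in> F N \<Longrightarrow> Lp_integrable M p (g i)"
    and bound: "\<And>N. (\<Sum>i\<in>F N. Lp_seminorm M p (g i)) \<le> B"
  obtains G :: "'a \<Rightarrow> real" where "Lp_integrable M p G"
    "AE x in M. (\<lambda>N. \<Sum>i\<in>F N. g i x) \<longlonglongrightarrow> lim (\<lambda>N. \<Sum>i\<in>F N. g i x)"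
    "AE x in M. \<forall>N. norm (\<Sum>i\<in>F N. g i x) \<le> G x"
proof -
  obtain G where G: "Lp_integrable M p G" and AE_G: "AE x in M. \<forall>N. (\<Sum>i\<in>F N. norm (g i x)) \<le> G x"
    using p F g bound by (rule Lp_majorant_of_series)
  have "AE x in M. (\<lambda>N. \<Sum>i\<in>F N. g i x) \<longlonglongrightarrow> lim (\<lambda>N. \<Sum>i\<in>F N. g i x)"
    using AE_G
  proof eventually_elim
    case (elim x)
    then have "convergent (\<lambda>N. \<Sum>i\<in>F N. g i x)"
      using F by (intro convergent_sums_incseq) auto
    then show ?case
      by (simp add: convergent_LIMSEQ_iff)
  qed
  moreover have "AE x in M. \<forall>N. norm (\<Sum>i\<in>F N. g i x) \<le> G x"
    using AE_G by eventually_elim (auto intro: order_trans[OF norm_sum])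
  ultimately show thesis
    by (rule that[OF G])
qed

lemma Lp_integrable_series:
  fixes g :: "'i \<Rightarrow> 'a \<Rightarrow> 'b::{banach, second_countable_topology}"
  assumes p: "1 < p" and "incseq F" "\<And>N. finite (F N)"
    and g: "\<And>i N. i \<in> F N \<Longrightarrow> Lp_integrable M p (g i)"
    and "\<And>N. (\<Sum>i\<in>F N. Lp_seminorm M p (g i)) \<le> B"
  shows "Lp_integrable M p (\<lambda>x. lim (\<lambda>N. \<Sum>i\<in>F N. g i x))"
proof -
  have [measurable]: "(\<lambda>x. \<Sum>i\<in>F N. g i x) \<in> borel_measurable M" for N
    using g by (intro borel_measurable_sum) auto
  obtain G :: "'a \<Rightarrow> real" where G: "Lp_integrable M p G"
    and AE_lim: "AE x in M. (\<lambda>N. \<Sum>i\<in>F N. g i x) \<longlonglongrightarrow> lim (\<lambda>N. \<Sum>i\<in>F N. g i x)"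
    and AE_le: "AE x in M. \<forall>N. norm (\<Sum>i\<in>F N. g i x) \<le> G x"
    using assms by (rule Lp_series_dominated)
  have "AE x in M. norm (lim (\<lambda>N. \<Sum>i\<in>F N. g i x)) \<le> norm (G x)"
    using AE_lim AE_le
  proof eventually_elim
    case (elim x)
    then have "norm (lim (\<lambda>N. \<Sum>i\<in>F N. g i x)) \<le> G x"
      by (intro LIMSEQ_le_const2[OF tendsto_norm]) auto
    then show ?case
      by simp
  qed
  then show ?thesis
    using p by (intro Lp_integrable_bound[OF G]) auto
qed

lemma tendsto_integral_Lp_series:
  fixes g :: "'i \<Rightarrow> 'a \<Rightarrow> 'b::{real_normed_field, banach, second_countable_topology}"
  assumes p: "1 < p" and F: "incseq F" "\<And>N. finite (F N)"
    and g: "\<And>i N. i \<in> F N \<Longrightarrow> Lp_integrable M p (g i)"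
    and bound: "\<And>N. (\<Sum>i\<in>F N. Lp_seminorm M p (g i)) \<le> B"
    and f: "Lp_integrable M q f" and pq: "1/p + 1/q = 1"
  shows "(\<lambda>N. \<Sum>i\<in>F N. \<integral>x. g i x * f x \<partial>M) \<longlonglongrightarrow> (\<integral>x. lim (\<lambda>N. \<Sum>i\<in>F N. g i x) * f x \<partial>M)"
proof -
  have [measurable]: "f \<in> borel_measurable M" "(\<lambda>x. \<Sum>i\<in>F N. g i x) \<in> borel_measurable M" for N
    using f g by (auto intro: borel_measurable_sum)
  obtain G :: "'a \<Rightarrow> real" where G: "Lp_integrable M p G"
    and AE_lim: "AE x in M. (\<lambda>N. \<Sum>i\<in>F N. g i x) \<longlonglongrightarrow> lim (\<lambda>N. \<Sum>i\<in>F N. g i x)"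
    and AE_le: "AE x in M. \<forall>N. norm (\<Sum>i\<in>F N. g i x) \<le> G x"
    using p F g bound by (rule Lp_series_dominated)
  have "(\<lambda>N. \<integral>x. (\<Sum>i\<in>F N. g i x) * f x \<partial>M) \<longlonglongrightarrow> (\<integral>x. lim (\<lambda>N. \<Sum>i\<in>F N. g i x) * f x \<partial>M)"
  proof (rule integral_dominated_convergence[where w="\<lambda>x. G x * norm (f x)"])
    show "integrable M (\<lambda>x. G x * norm (f x))"
      by (rule Holder_integrable[OF G Lp_integrable_norm[OF f] p pq])
    show "AE x in M. (\<lambda>N. (\<Sum>i\<in>F N. g i x) * f x) \<longlonglongrightarrow> lim (\<lambda>N. \<Sum>i\<in>F N. g i x) * f x"
      using AE_lim by eventually_elim (intro tendsto_intros)
    show "AE x in M. norm ((\<Sum>i\<in>F N. g i x) * f x) \<le> G x * norm (f x)" for N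
      using AE_le by eventually_elim (simp add: norm_mult mult_right_mono)
  qed measurable
  moreover have "(\<integral>x. (\<Sum>i\<in>F N. g i x) * f x \<partial>M) = (\<Sum>i\<in>F N. \<integral>x. g i x * f x \<partial>M)" for N
    unfolding sum_distrib_right using Holder_integrable[OF g f p pq]
    by (intro Bochner_Integration.integral_sum) auto
  ultimately show ?thesis
    by simp
qed

section \<open>Differentiability of the norm of \<open>L\<^sup>p\<close>\<close>

definition duality_map :: "real \<Rightarrow> complex \<Rightarrow> complex" where
  "duality_map p a = cnj a * of_real (norm a powr (p - 2))"

lemma norm_duality_map: "norm (duality_map p a) = norm a powr (p - 1)"
  by (cases "a = 0") (simp_all add: duality_map_def norm_mult powr_mult_base)

lemma mult_duality_map: "a * duality_map p a = of_real (norm a powr p)"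
proof (cases "a = 0")
  case False
  have "a * duality_map p a = of_real ((norm a)\<^sup>2 * norm a powr (p - 2))"
    by (simp add: duality_map_def complex_norm_square[symmetric] mult.assoc[symmetric])
  also have "(norm a)\<^sup>2 * norm a powr (p - 2) = norm a powr p"
    using False by (simp add: powr_diff)
  finally show ?thesis .
qed (simp add: duality_map_def)

lemma duality_map_mult: "duality_map p (a * b) = duality_map p a * duality_map p b"
  by (simp add: duality_map_def norm_mult powr_mult)

lemma duality_map_unit: "norm a = 1 \<Longrightarrow> duality_map p a = cnj a"
  by (simp add: duality_map_def)

lemma borel_measurable_duality_map [measurable]: "duality_map p \<in> borel_measurable borel"
proof -
  have [measurable]: "cnj \<in> borel_measurable borel"
    by (intro borel_measurable_continuous_onI continuous_intros)
  show ?thesis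
    unfolding duality_map_def[abs_def] by measurable
qed

lemma
  fixes f :: "'a \<Rightarrow> complex"
  assumes f: "Lp_integrable M p f" and pq: "1 < p" "1/p + 1/q = 1"
  shows Lp_integrable_duality_map: "Lp_integrable M q (\<lambda>x. duality_map p (f x))"
    and Lp_seminorm_duality_map: "Lp_seminorm M q (\<lambda>x. duality_map p (f x)) = Lp_seminorm M p f powr (p - 1)"
proof -
  have [measurable]: "f \<in> borel_measurable M"
    using f by auto
  show "Lp_integrable M q (\<lambda>x. duality_map p (f x))"
    using Lp_integrable_norm_powr[OF assms] by (simp add: Lp_integrable_def norm_duality_map)
  show "Lp_seminorm M q (\<lambda>x. duality_map p (f x)) = Lp_seminorm M p f powr (p - 1)"
    using Lp_seminorm_norm_powr[OF assms] by (simp add: Lp_seminorm_def norm_duality_map)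
qed

lemma has_real_derivative_norm_powr:
  fixes a b :: complex
  assumes p: "1 < p"
  shows "((\<lambda>s. norm (a + of_real s * b) powr p) has_real_derivative p * Re (b * duality_map p a)) (at 0)"
proof (cases "a = 0")
  case True
  have "((\<lambda>s::real. \<bar>s\<bar> powr (p - 1)) \<longlongrightarrow> \<bar>0\<bar> powr (p - 1)) (at 0)"
    using p by (intro tendsto_powr' tendsto_rabs tendsto_ident_at tendsto_const) auto
  then have "((\<lambda>s. \<bar>s\<bar> powr (p - 1) * norm b powr p) \<longlongrightarrow> 0) (at 0)"
    using p by (auto intro: tendsto_mult_left_zero)
  then have "((\<lambda>s. \<bar>s\<bar> powr p * norm b powr p / s) \<longlongrightarrow> 0) (at 0)"
    by (rule Lim_null_comparison[rotated]) (simp add: abs_mult powr_diff)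
  then show ?thesis
    using True p by (simp add: DERIV_def duality_map_def norm_mult powr_mult)
next
  case False
  have "((\<lambda>s::real. (norm (a + of_real s * b))\<^sup>2) has_real_derivative 2 * Re (b * cnj a)) (at 0)"
    unfolding cmod_power2 by (auto intro!: derivative_eq_intros simp: algebra_simps)
  then have "((\<lambda>s::real. ((norm (a + of_real s * b))\<^sup>2) powr (p/2)) has_real_derivative
      (p/2) * ((norm a)\<^sup>2) powr (p/2 - 1) * (2 * Re (b * cnj a))) (at 0)"
    using has_real_derivative_powr[of "(norm a)\<^sup>2" "p/2"] False
    by (intro DERIV_chain2[where f="\<lambda>t. t powr (p/2)" and g="\<lambda>s. (norm (a + of_real s * b))\<^sup>2"]) simp_all
  moreover have "(x\<^sup>2) powr r = x powr (2 * r)" if "x \<ge> 0" for x r :: real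
    using that by (cases "x = 0") (auto simp: powr_powr simp flip: powr_numeral)
  ultimately show ?thesis
    by (simp add: duality_map_def algebra_simps)
qed

lemma powr_diff_le_tangent:
  fixes x y p :: real
  assumes "0 \<le> x" "0 \<le> y" and p: "1 < p"
  shows "x powr p - y powr p \<le> p * x powr (p - 1) * (x - y)"
proof -
  obtain q where pq: "1/p + 1/q = 1"
    by (rule ex_conjugate_exponent[OF p])
  note q = conjugate_exponent[OF p pq]
  have "p / q = p - 1"
    using q by (simp add: field_simps)
  have "y * x powr (p - 1) \<le> y powr p / p + (x powr (p - 1)) powr q / q"
    using assms pq q(1) by (intro Youngs_inequality) auto
  then have "p * (y * x powr (p - 1)) \<le> p * (y powr p / p + x powr p / q)"
    using p by (intro mult_left_mono) (simp_all add: powr_powr q(2))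
  also have "\<dots> = y powr p + (p - 1) * x powr p"
    using p by (simp add: distrib_left \<open>p / q = p - 1\<close>[symmetric])
  finally have "p * (y * x powr (p - 1)) \<le> y powr p + (p - 1) * x powr p" .
  moreover have "x powr p = x * x powr (p - 1)"
    using assms by (simp add: powr_mult_base)
  ultimately show ?thesis
    by (simp add: algebra_simps)
qed

lemma abs_powr_diff_le:
  fixes x y c p :: real
  assumes "0 \<le> x" "0 \<le> y" "x \<le> c" "y \<le> c" and p: "1 < p"
  shows "\<bar>x powr p - y powr p\<bar> \<le> p * c powr (p - 1) * \<bar>x - y\<bar>"
proof -
  have "u powr p - v powr p \<le> p * c powr (p - 1) * \<bar>u - v\<bar>" if "0 \<le> u" "0 \<le> v" "u \<le> c" for u v
  proof -
    have "u powr p - v powr p \<le> p * u powr (p - 1) * (u - v)"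
      using that p by (intro powr_diff_le_tangent)
    also have "\<dots> \<le> p * u powr (p - 1) * \<bar>u - v\<bar>"
      using p by (intro mult_left_mono) auto
    also have "\<dots> \<le> p * c powr (p - 1) * \<bar>u - v\<bar>"
      using that p by (intro mult_right_mono mult_left_mono powr_mono2) auto
    finally show ?thesis .
  qed
  from this[of x y] this[of y x] show ?thesis
    using assms by (simp add: abs_minus_commute abs_le_iff)
qed

lemma has_real_derivative_integral:
  fixes f :: "real \<Rightarrow> 'a \<Rightarrow> real"
  assumes S: "open S" "t \<in> S"
    and f: "\<And>s. s \<in> S \<Longrightarrow> integrable M (f s)" and "f' \<in> borel_measurable M" and w: "integrable M w"
    and deriv: "AE x in M. ((\<lambda>s. f s x) has_real_derivative f' x) (at t)"
    and bound: "\<And>s. s \<in> S \<Longrightarrow> AE x in M. \<bar>f s x - f t x\<bar> \<le> w x * \<bar>s - t\<bar>"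
  shows "((\<lambda>s. \<integral>x. f s x \<partial>M) has_real_derivative (\<integral>x. f' x \<partial>M)) (at t)"
proof -
  have "((\<lambda>s. ((\<integral>x. f s x \<partial>M) - (\<integral>x. f t x \<partial>M)) / (s - t)) \<longlongrightarrow> (\<integral>x. f' x \<partial>M)) (at t within S)"
    unfolding tendsto_at_iff_sequentially
  proof (intro allI impI)
    fix X :: "nat \<Rightarrow> real"
    assume "\<forall>i. X i \<in> S - {t}" and lim: "X \<longlonglongrightarrow> t"
    then have X: "X i \<in> S" "X i \<noteq> t" for i
      by auto
    then have filt: "filterlim X (at t) sequentially"
      using lim by (simp add: filterlim_at)
    have "(\<lambda>i. \<integral>x. (f (X i) x - f t x) / (X i - t) \<partial>M) \<longlonglongrightarrow> (\<integral>x. f' x \<partial>M)"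
    proof (rule integral_dominated_convergence[where w=w])
      show "f' \<in> borel_measurable M" "integrable M w" by fact+
      show "(\<lambda>x. (f (X i) x - f t x) / (X i - t)) \<in> borel_measurable M" for i
        using borel_measurable_integrable[OF f[OF X(1)[of i]]] borel_measurable_integrable[OF f[OF S(2)]]
        by measurable
      show "AE x in M. (\<lambda>i. (f (X i) x - f t x) / (X i - t)) \<longlonglongrightarrow> f' x"
        using deriv
      proof eventually_elim
        case (elim x)
        then show ?case
          using filt unfolding has_field_derivative_iff by (rule filterlim_compose)
      qed
      show "AE x in M. norm ((f (X i) x - f t x) / (X i - t)) \<le> w x" for i
        using bound[OF X(1)[of i]] by eventually_elim (simp add: pos_divide_le_eq X(2))
    qed
    moreover have "(\<integral>x. (f (X i) x - f t x) / (X i - t) \<partial>M)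
        = ((\<integral>x. f (X i) x \<partial>M) - (\<integral>x. f t x \<partial>M)) / (X i - t)" for i
      by (simp add: f X(1) S(2))
    ultimately show "((\<lambda>s. ((\<integral>x. f s x \<partial>M) - (\<integral>x. f t x \<partial>M)) / (s - t)) \<circ> X) \<longlonglongrightarrow> (\<integral>x. f' x \<partial>M)"
      by (simp only: o_def)
  qed
  then show ?thesis
    by (simp only: has_field_derivative_iff at_within_open[OF S(2,1)])
qed

lemma abs_norm_add_powr_diff_le:
  fixes a b :: complex and s p :: real
  assumes s: "\<bar>s\<bar> \<le> 1" and p: "1 < p"
  shows "\<bar>norm (a + of_real s * b) powr p - norm a powr p\<bar> \<le> p * (norm a + norm b) powr p * \<bar>s\<bar>"
proof -
  let ?c = "norm a + norm b"
  have sb: "norm (of_real s * b) = \<bar>s\<bar> * norm b"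
    by (simp add: norm_mult)
  also have "\<dots> \<le> norm b"
    using s by (intro mult_left_le_one_le) auto
  finally have "norm (a + of_real s * b) \<le> ?c"
    using norm_triangle_ineq[of a "of_real s * b"] by simp
  then have "\<bar>norm (a + of_real s * b) powr p - norm a powr p\<bar>
      \<le> p * ?c powr (p - 1) * \<bar>norm (a + of_real s * b) - norm a\<bar>"
    using p by (intro abs_powr_diff_le) auto
  also have "\<dots> \<le> p * ?c powr (p - 1) * (\<bar>s\<bar> * ?c)"
  proof (rule mult_left_mono)
    have "\<bar>norm (a + of_real s * b) - norm a\<bar> \<le> \<bar>s\<bar> * norm b"
      using norm_triangle_ineq3[of "a + of_real s * b" a] sb by simp
    also have "\<dots> \<le> \<bar>s\<bar> * ?c"
      by (intro mult_left_mono) auto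
    finally show "\<bar>norm (a + of_real s * b) - norm a\<bar> \<le> \<bar>s\<bar> * ?c" .
  qed (use p in simp)
  also have "\<dots> = p * ?c powr p * \<bar>s\<bar>"
    using powr_mult_base[of ?c "p - 1"] by (simp add: mult_ac)
  finally show ?thesis .
qed

lemma has_real_derivative_integral_norm_powr:
  fixes e h :: "'a \<Rightarrow> complex"
  assumes e: "Lp_integrable M p e" and h: "Lp_integrable M p h" and p: "1 < p"
  shows "((\<lambda>s. \<integral>x. norm (e x + of_real s * h x) powr p \<partial>M) has_real_derivative
      p * Re (\<integral>x. h x * duality_map p (e x) \<partial>M)) (at 0)"
proof -
  obtain q where pq: "1/p + 1/q = 1"
    by (rule ex_conjugate_exponent[OF p])
  have [measurable]: "e \<in> borel_measurable M" "h \<in> borel_measurable M"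
    using e h by auto
  have pairing: "integrable M (\<lambda>x. h x * duality_map p (e x))"
    using h Lp_integrable_duality_map[OF e p pq] p pq by (rule Holder_integrable)
  have "((\<lambda>s. \<integral>x. norm (e x + of_real s * h x) powr p \<partial>M) has_real_derivative
      (\<integral>x. p * Re (h x * duality_map p (e x)) \<partial>M)) (at 0)"
  proof (rule has_real_derivative_integral[where S="{-1<..<1}"])
    show "integrable M (\<lambda>x. norm (e x + of_real s * h x) powr p)" for s
      using e h p by (intro Lp_integrable_powr Lp_integrable_add Lp_integrable_mult_left) auto
    have "Lp_integrable M p (\<lambda>x. norm (e x) + norm (h x))"
      using e h p by (intro Lp_integrable_add Lp_integrable_norm) auto
    then show "integrable M (\<lambda>x. p * (norm (e x) + norm (h x)) powr p)"
      using p by (auto dest: Lp_integrable_powr)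
    show "AE x in M. ((\<lambda>s. norm (e x + of_real s * h x) powr p)
        has_real_derivative p * Re (h x * duality_map p (e x))) (at 0)"
      using has_real_derivative_norm_powr[OF p] by simp
    show "AE x in M. \<bar>norm (e x + of_real s * h x) powr p - norm (e x + of_real 0 * h x) powr p\<bar>
        \<le> p * (norm (e x) + norm (h x)) powr p * \<bar>s - 0\<bar>" if "s \<in> {-1<..<1}" for s :: real
    proof -
      have "\<bar>s\<bar> \<le> 1"
        using that by auto
      then show ?thesis
        by (simp add: abs_norm_add_powr_diff_le p)
    qed
  qed auto
  then show ?thesis
    by (simp only: integral_mult_right_zero integral_Re[OF pairing])
qed

text \<open>Both sides of the hypothesis agree at \<open>s = 0\<close>, so their \<open>p\<close>-th powers have the same derivative there.\<close>
lemma Re_eq_if_Lp_seminorm_supported: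
  fixes e h :: "'a \<Rightarrow> complex" and c :: complex
  assumes p: "1 < p" and e: "Lp_integrable M p e" and h: "Lp_integrable M p h"
    and supported: "\<And>s::real. norm (1 + of_real s * c) * Lp_seminorm M p e
      \<le> Lp_seminorm M p (\<lambda>x. e x + of_real s * h x)"
  shows "Re c * Lp_seminorm M p e powr p = Re (\<integral>x. h x * duality_map p (e x) \<partial>M)"
proof -
  define I where "I = Lp_seminorm M p e powr p"
  define J where "J = (\<integral>x. h x * duality_map p (e x) \<partial>M)"
  define D where "D s = (\<integral>x. norm (e x + of_real s * h x) powr p \<partial>M)
      - norm (1 + of_real s * c) powr p * I" for s
  have "(D has_real_derivative p * Re J - p * Re c * I) (at 0)"
    unfolding D_def[abs_def] J_def using has_real_derivative_norm_powr[OF p, of 1 c]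
    by (intro DERIV_diff DERIV_cmult_right has_real_derivative_integral_norm_powr e h p)
      (simp add: duality_map_def)
  moreover have "D 0 \<le> D s" for s
  proof -
    have "(norm (1 + of_real s * c) * Lp_seminorm M p e) powr p
        \<le> Lp_seminorm M p (\<lambda>x. e x + of_real s * h x) powr p"
      using p supported[of s] by (intro powr_mono2) auto
    then have "0 \<le> D s"
      using p by (simp add: D_def I_def powr_mult Lp_seminorm_powr)
    moreover have "D 0 = 0"
      using p by (simp add: D_def I_def Lp_seminorm_powr)
    ultimately show ?thesis
      by simp
  qed
  ultimately have "p * Re J - p * Re c * I = 0"
    by (intro DERIV_local_min[of D _ 0 1]) auto
  then show ?thesis
    using p by (simp add: I_def J_def algebra_simps)
qed

lemma norming_functional_eq:
  fixes \<Phi> :: "('a \<Rightarrow> complex) \<Rightarrow> complex"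
  assumes p: "1 < p" and e: "Lp_integrable M p e" and one: "\<Phi> e = 1"
    and add: "\<And>f g. Lp_integrable M p f \<Longrightarrow> Lp_integrable M p g \<Longrightarrow> \<Phi> (\<lambda>x. f x + g x) = \<Phi> f + \<Phi> g"
    and mult: "\<And>f c. Lp_integrable M p f \<Longrightarrow> \<Phi> (\<lambda>x. c * f x) = c * \<Phi> f"
    and bound: "\<And>f. Lp_integrable M p f \<Longrightarrow> norm (\<Phi> f) * Lp_seminorm M p e \<le> Lp_seminorm M p f"
    and f: "Lp_integrable M p f"
  shows "\<Phi> f * of_real (Lp_seminorm M p e powr p) = (\<integral>x. f x * duality_map p (e x) \<partial>M)"
proof -
  have Re_eq: "Re (\<Phi> h) * Lp_seminorm M p e powr p = Re (\<integral>x. h x * duality_map p (e x) \<partial>M)"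
    if h: "Lp_integrable M p h" for h
  proof (rule Re_eq_if_Lp_seminorm_supported[OF p e h])
    fix s :: real
    have sh: "Lp_integrable M p (\<lambda>x. of_real s * h x)"
      by (rule Lp_integrable_mult_left[OF h])
    have "\<Phi> (\<lambda>x. e x + of_real s * h x) = 1 + of_real s * \<Phi> h"
      by (simp add: add[OF e sh] mult[OF h] one)
    then show "norm (1 + of_real s * \<Phi> h) * Lp_seminorm M p e \<le> Lp_seminorm M p (\<lambda>x. e x + of_real s * h x)"
      using bound[OF Lp_integrable_add[OF e sh]] p by simp
  qed
  have "Im (\<Phi> f) * Lp_seminorm M p e powr p = Im (\<integral>x. f x * duality_map p (e x) \<partial>M)"
    using Re_eq[OF Lp_integrable_mult_left[OF f, of "- \<i>"]]
    by (simp add: mult[OF f, of "- \<i>", simplified] mult.assoc)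
  with Re_eq[OF f] show ?thesis
    by (simp add: complex_eq_iff)
qed

section \<open>The torus action and monomials\<close>

text \<open>The product \<open>u * z\<close> of vectors is componentwise, so it is the action of the torus.\<close>
definition torus :: "(complex^'n) set" where
  "torus = {u. \<forall>j. norm (u$j) = 1}"

lemma orthogonal_transformation_mult_torus:
  fixes u :: "complex^'n"
  assumes "u \<in> torus"
  shows "orthogonal_transformation ((*) u)"
proof -
  have "linear ((*) u)"
    by (rule linearI) (simp_all add: vec_eq_iff algebra_simps)
  then show ?thesis
    using assms by (simp add: orthogonal_transformation norm_vec_def torus_def norm_mult)
qed

lemma reinhardt_mult_torus:
  assumes "reinhardt \<Omega>" "u \<in> torus" "z \<in> \<Omega>"
  shows "u * z \<in> \<Omega>"
proof -
  have "exp (\<i> * of_real (Arg (u$j))) = u$j" for j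
    using cis_Arg_unique assms(2) rcis_cmod_Arg[of "u$j"] by (simp add: torus_def cis_conv_exp rcis_def)
  then have "u * z = (\<chi> j. exp (\<i> * of_real (Arg (u$j))) * z$j)"
    by (simp add: vec_eq_iff)
  then show ?thesis
    using assms by (simp add: reinhardt_def)
qed

lemma reinhardt_mult_torus_iff:
  assumes "reinhardt \<Omega>" "u \<in> torus"
  shows "u * z \<in> \<Omega> \<longleftrightarrow> z \<in> \<Omega>"
proof
  define v where "v = (\<chi> j. inverse (u$j))"
  have v: "v \<in> torus"
    using assms(2) by (simp add: v_def torus_def norm_inverse)
  have "u$j \<noteq> 0" for j
    using assms(2) by (metis (mono_tags) mem_Collect_eq norm_zero torus_def zero_neq_one)
  then have "v * (u * z) = z"
    by (simp add: v_def vec_eq_iff)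
  then show "z \<in> \<Omega>" if "u * z \<in> \<Omega>"
    using reinhardt_mult_torus[OF assms(1) v that] by simp
qed (rule reinhardt_mult_torus[OF assms])

lemma multi_radial_mult_torus:
  assumes \<Omega>: "reinhardt \<Omega>" and wt: "multi_radial \<Omega> wt" and u: "u \<in> torus"
  shows "wt (u * z) * indicator \<Omega> (u * z) = wt z * indicator \<Omega> z"
proof (cases "z \<in> \<Omega>")
  case True
  moreover have "norm ((u * z)$j) = norm (z$j)" for j
    using u by (simp add: torus_def norm_mult)
  ultimately have "wt (u * z) = wt z"
    using wt reinhardt_mult_torus[OF \<Omega> u True] by (metis multi_radial_def)
  then show ?thesis
    by (simp add: indicator_def reinhardt_mult_torus_iff[OF \<Omega> u])
qed (simp add: reinhardt_mult_torus_iff[OF \<Omega> u])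

lemma
  assumes \<Omega>: "reinhardt \<Omega>" and wt: "multi_radial \<Omega> wt" and u: "u \<in> torus"
    and meas: "(\<lambda>z. wt z * indicator \<Omega> z) \<in> borel_measurable lebesgue"
  shows measurable_wmeasure_mult_torus: "(*) u \<in> wmeasure \<Omega> wt \<rightarrow>\<^sub>M wmeasure \<Omega> wt"
    and distr_wmeasure_mult_torus: "distr (wmeasure \<Omega> wt) (wmeasure \<Omega> wt) ((*) u) = wmeasure \<Omega> wt"
proof -
  have T: "orthogonal_transformation ((*) u)"
    by (rule orthogonal_transformation_mult_torus[OF u])
  have "(*) u \<in> borel_measurable borel"
    using orthogonal_transformation_linear[OF T]
    by (intro borel_measurable_continuous_onI linear_continuous_on) (simp add: linear_linear)
  note inv = this distr_lborel_orthogonal_transformation[OF T]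
  show "(*) u \<in> wmeasure \<Omega> wt \<rightarrow>\<^sub>M wmeasure \<Omega> wt"
    using measurable_lebesgue_if_distr_lborel[OF inv] by (simp add: wmeasure_def)
  show "distr (wmeasure \<Omega> wt) (wmeasure \<Omega> wt) ((*) u) = wmeasure \<Omega> wt"
    unfolding wmeasure_def
    by (intro distr_density_invariant measurable_lebesgue_if_distr_lborel distr_lebesgue_if_distr_lborel
        inv meas multi_radial_mult_torus \<Omega> wt u)
qed

lemma monom_mult: "monom \<alpha> (z * w) = monom \<alpha> z * monom \<alpha> w"
  by (simp add: monom_def power_int_mult_distrib prod.distrib)

lemma norm_monom_torus: "u \<in> torus \<Longrightarrow> norm (monom \<alpha> u) = 1"
  by (simp add: monom_def torus_def norm_power_int flip: prod_norm)

lemma torus_separates_monoms: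
  fixes \<alpha> \<beta> :: "'n::finite \<Rightarrow> int"
  assumes "\<alpha> \<noteq> \<beta>"
  obtains u where "u \<in> torus" "monom \<alpha> u = - monom \<beta> u"
proof -
  obtain j where j: "\<alpha> j \<noteq> \<beta> j"
    using assms by auto
  define c where "c = cis (pi / of_int (\<alpha> j - \<beta> j))"
  define u :: "complex^'n" where "u = (\<chi> i. if i = j then c else 1)"
  have monom_u: "monom \<gamma> u = c powi \<gamma> j" for \<gamma>
  proof -
    have "monom \<gamma> u = (\<Prod>i\<in>UNIV. if i = j then c powi \<gamma> j else 1)"
      unfolding monom_def u_def by (rule prod.cong) auto
    then show ?thesis by simp
  qed
  have "c powi \<alpha> j = c powi (\<alpha> j - \<beta> j) * c powi \<beta> j"
    by (simp add: c_def flip: power_int_add)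
  also have "c powi (\<alpha> j - \<beta> j) = -1"
    unfolding c_def cis_power_int using j by simp
  finally have "monom \<alpha> u = - monom \<beta> u"
    by (simp add: monom_u)
  moreover have "u \<in> torus"
    by (simp add: torus_def u_def c_def)
  ultimately show thesis
    by (rule that[rotated])
qed

lemma borel_measurable_monom [measurable]:
  fixes \<alpha> :: "'n::finite \<Rightarrow> int"
  shows "monom \<alpha> \<in> borel_measurable borel"
proof -
  have "(\<lambda>z::complex^'n. (z$j) powi k) \<in> borel_measurable borel" for j :: 'n and k
  proof -
    have [measurable]: "(\<lambda>z::complex^'n. z$j) \<in> borel_measurable borel"
      by (intro borel_measurable_continuous_onI continuous_intros)
    show ?thesis
      unfolding power_int_def by (cases "k \<ge> 0") simp_all
  qed
  then show ?thesis
    unfolding monom_def[abs_def] by (intro borel_measurable_prod)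
qed

lemma open_has_nonzero_coordinates:
  fixes \<Omega> :: "(complex^'n) set"
  assumes "open \<Omega>" "\<Omega> \<noteq> {}"
  obtains a where "a \<in> \<Omega>" "\<And>j. a$j \<noteq> 0"
proof -
  obtain b where b: "b \<in> \<Omega>"
    using assms by auto
  define S where "S = (\<lambda>t. \<chi> j. b$j + t) -` \<Omega>"
  have "open S"
    unfolding S_def by (intro open_vimage assms continuous_intros)
  moreover have "0 \<in> S"
    using b by (simp add: S_def)
  ultimately have "\<not> S \<subseteq> range (\<lambda>j. - b$j)"
    using finite_imp_not_open[of S] finite_subset by fastforce
  then obtain t where t: "t \<in> S" "t \<notin> range (\<lambda>j. - b$j)"
    by blast
  show thesis
  proof
    show "(\<chi> j. b$j + t) \<in> \<Omega>"
      using t(1) by (simp add: S_def)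
    show "(\<chi> j. b$j + t)$j \<noteq> 0" for j
      using t(2) by (auto simp: add_eq_0_iff)
  qed
qed

lemma summable_on_prod_geometric:
  fixes r :: real
  assumes r: "0 \<le> r" "r < 1"
  shows "(\<lambda>\<alpha>::'n::finite \<Rightarrow> int. \<Prod>j\<in>UNIV. r ^ nat \<bar>\<alpha> j\<bar>) summable_on UNIV"
proof -
  have geometric: "(\<lambda>n. r ^ n) summable_on UNIV"
    using r summable_geometric[of r] by (subst summable_on_UNIV_nonneg_real_iff) auto
  have "(\<lambda>k::int. r ^ nat \<bar>k\<bar>) summable_on (range int \<union> range (\<lambda>n. - int n))"
    using geometric by (intro summable_on_union) (auto simp: summable_on_reindex inj_on_def o_def)
  moreover have "k \<in> range int \<union> range (\<lambda>n. - int n)" for k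
    by (cases k rule: int_cases2) auto
  then have "range int \<union> range (\<lambda>n. - int n) = UNIV"
    by blast
  ultimately have "(\<lambda>k::int. norm (r ^ nat \<bar>k\<bar>)) summable_on UNIV"
    using r by simp
  then show ?thesis
    using abs_summable_on_prod_PiE[of UNIV "\<lambda>_::'n. UNIV" "\<lambda>_ k::int. r ^ nat \<bar>k\<bar>"] r
    by (simp add: abs_summable_equivalent[symmetric] prod_nonneg)
qed

text \<open>Moving each coordinate away from the origin or towards it, according to the sign of its exponent,
  enlarges every factor of the monomial.\<close>
definition dilation :: "real \<Rightarrow> ('n::finite \<Rightarrow> int) \<Rightarrow> complex^'n" where
  "dilation s \<alpha> = (\<chi> j. of_real (s powi sgn (\<alpha> j)))"

lemma monom_dilation: "monom \<alpha> (dilation s \<alpha>) = of_real (\<Prod>j\<in>UNIV. s ^ nat \<bar>\<alpha> j\<bar>)"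
proof -
  have "(s powi sgn k) powi k = s ^ nat \<bar>k\<bar>" for k
  proof -
    have "(s powi sgn k) powi k = s powi \<bar>k\<bar>"
      by (simp only: power_int_mult[symmetric] abs_sgn mult.commute)
    then show ?thesis
      by (simp add: power_int_def)
  qed
  then show ?thesis
    by (simp add: monom_def dilation_def flip: of_real_power_int)
qed

lemma dist_dilation_le:
  assumes s: "1 \<le> s"
  shows "dist z (dilation s \<alpha> * z) \<le> (s - 1) * norm z"
proof -
  have "norm (dilation s \<alpha> $ j - 1) \<le> s - 1" for j
  proof -
    have "1 - inverse s = inverse s * (s - 1)"
      using s by (simp add: field_simps)
    also have "\<dots> \<le> 1 * (s - 1)"
      using s by (intro mult_right_mono) (auto simp: inverse_le_1_iff)
    finally have "1 - inverse s \<le> s - 1" "inverse s \<le> 1"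
      using s by (auto simp: inverse_le_1_iff)
    then have "\<bar>s powi sgn (\<alpha> j) - 1\<bar> \<le> s - 1"
      using s by (cases "\<alpha> j" "0::int" rule: linorder_cases) (auto simp: abs_if)
    moreover have "dilation s \<alpha> $ j - 1 = of_real (s powi sgn (\<alpha> j) - 1)"
      by (simp add: dilation_def)
    ultimately show ?thesis
      by (simp only: norm_of_real)
  qed
  then have "norm ((dilation s \<alpha> $ j - 1) * z$j) \<le> (s - 1) * norm (z$j)" for j
    unfolding norm_mult by (intro mult_right_mono) auto
  then have "norm (dilation s \<alpha> * z - z) \<le> norm ((s - 1) *\<^sub>R z)"
    using s by (intro norm_le_componentwise_cart) (simp add: left_diff_distrib)
  then show ?thesis
    using s by (simp add: dist_norm norm_minus_commute)
qed

lemma norm_monom_eq_dilation: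
  assumes "0 < s"
  shows "norm (monom \<alpha> z) = (\<Prod>j\<in>UNIV. (1 / s) ^ nat \<bar>\<alpha> j\<bar>) * norm (monom \<alpha> (dilation s \<alpha> * z))"
proof -
  have "norm (monom \<alpha> (dilation s \<alpha> * z)) = (\<Prod>j\<in>UNIV. s ^ nat \<bar>\<alpha> j\<bar>) * norm (monom \<alpha> z)"
    using assms by (simp add: monom_mult monom_dilation norm_mult prod_nonneg del: of_real_prod)
  moreover have "(\<Prod>j\<in>UNIV. (1 / s) ^ nat \<bar>\<alpha> j\<bar>) = 1 / (\<Prod>j\<in>UNIV. s ^ nat \<bar>\<alpha> j\<bar>)"
    by (simp add: power_divide prod_dividef)
  moreover have "(\<Prod>j\<in>UNIV. s ^ nat \<bar>\<alpha> j\<bar>) \<noteq> 0"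
    using assms by simp
  ultimately show ?thesis
    by simp
qed

lemma compact_neighbourhood_of_dilations:
  fixes K :: "(complex^'n::finite) set"
  assumes "open \<Omega>" and K: "compact K" "K \<subseteq> \<Omega>"
  obtains K' s where "compact K'" "K' \<subseteq> \<Omega>" "1 < s" "\<And>\<alpha> z. z \<in> K \<Longrightarrow> dilation s \<alpha> * z \<in> K'"
proof -
  obtain \<epsilon> where \<epsilon>: "0 < \<epsilon>" "(\<Union>z\<in>K. cball z \<epsilon>) \<subseteq> \<Omega>"
    using compact_subset_open_imp_cball_epsilon_subset[OF K(1) assms(1) K(2)] by blast
  obtain R where R: "0 < R" "\<And>z. z \<in> K \<Longrightarrow> norm z \<le> R"
    using compact_imp_bounded[OF K(1)] by (auto simp: bounded_pos)
  define s where "s = 1 + \<epsilon> / R"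
  have s: "1 < s" "(s - 1) * R = \<epsilon>"
    using \<epsilon> R by (auto simp: s_def)
  have "dilation s \<alpha> * z \<in> cball z \<epsilon>" if "z \<in> K" for \<alpha> z
  proof -
    have "dist z (dilation s \<alpha> * z) \<le> (s - 1) * norm z"
      using s by (intro dist_dilation_le) auto
    also have "\<dots> \<le> (s - 1) * R"
      using R(2)[OF that] s by (intro mult_left_mono) auto
    finally show ?thesis
      by (simp add: s(2))
  qed
  then have "dilation s \<alpha> * z \<in> (\<Union>z\<in>K. cball z \<epsilon>)" if "z \<in> K" for \<alpha> z
    using that by blast
  with compact_minkowski_sum_cball[OF K(1)] \<epsilon>(2) s(1) show thesis
    by (rule that)
qed

section \<open>Laurent series\<close>

definition vanishing_series :: "(complex^'n::finite) set \<Rightarrow> (('n \<Rightarrow> int) \<Rightarrow> complex) \<Rightarrow> bool" where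
  "vanishing_series \<Omega> d \<longleftrightarrow> (\<forall>z\<in>\<Omega>. ((\<lambda>\<alpha>. d \<alpha> * monom \<alpha> z) has_sum 0) UNIV)"

text \<open>The mean of the series at \<open>z\<close> and of its multiple by \<open>1 / e\<^sub>\<beta>(u)\<close> at \<open>u z\<close>, for a rotation \<open>u\<close> with
  \<open>e\<^sub>\<gamma>(u) = - e\<^sub>\<beta>(u)\<close>, loses the term of index \<open>\<gamma>\<close> but keeps the one of index \<open>\<beta>\<close>.\<close>
lemma damp_vanishing_series:
  assumes \<Omega>: "reinhardt \<Omega>" and d: "vanishing_series \<Omega> d" and "\<beta> \<noteq> \<gamma>"
  obtains t where "t \<beta> = 1" "t \<gamma> = 0" "\<And>\<alpha>. norm (t \<alpha>) \<le> 1" "vanishing_series \<Omega> (\<lambda>\<alpha>. t \<alpha> * d \<alpha>)"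
proof -
  obtain u where u: "u \<in> torus" "monom \<gamma> u = - monom \<beta> u"
    using torus_separates_monoms[of \<gamma> \<beta>] \<open>\<beta> \<noteq> \<gamma>\<close> by auto
  have "monom \<beta> u \<noteq> 0"
    using norm_monom_torus[OF u(1), of \<beta>] by auto
  define t where "t \<alpha> = (1 + monom \<alpha> u / monom \<beta> u) / 2" for \<alpha>
  show thesis
  proof
    show "t \<beta> = 1" "t \<gamma> = 0"
      using \<open>monom \<beta> u \<noteq> 0\<close> by (simp_all add: t_def u(2))
    show "norm (t \<alpha>) \<le> 1" for \<alpha>
      using norm_triangle_ineq[of 1 "monom \<alpha> u / monom \<beta> u"]
      by (simp add: t_def norm_divide norm_monom_torus[OF u(1)])
    show "vanishing_series \<Omega> (\<lambda>\<alpha>. t \<alpha> * d \<alpha>)"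
      unfolding vanishing_series_def
    proof
      fix z assume z: "z \<in> \<Omega>"
      have "((\<lambda>\<alpha>. 1/2 * (d \<alpha> * monom \<alpha> z + 1 / monom \<beta> u * (d \<alpha> * monom \<alpha> (u * z))))
          has_sum 1/2 * (0 + 1 / monom \<beta> u * 0)) UNIV"
        using d z reinhardt_mult_torus[OF \<Omega> u(1) z]
        by (intro has_sum_cmult_right has_sum_add) (simp_all add: vanishing_series_def)
      then show "((\<lambda>\<alpha>. t \<alpha> * d \<alpha> * monom \<alpha> z) has_sum 0) UNIV"
        by (simp add: t_def monom_mult algebra_simps add_divide_distrib)
    qed
  qed
qed

lemma damp_vanishing_series_finite:
  assumes \<Omega>: "reinhardt \<Omega>" and d: "vanishing_series \<Omega> d" and F: "finite F" "\<beta> \<notin> F"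
  shows "\<exists>t. t \<beta> = 1 \<and> (\<forall>\<alpha>\<in>F. t \<alpha> = 0) \<and> (\<forall>\<alpha>. norm (t \<alpha>) \<le> 1) \<and> vanishing_series \<Omega> (\<lambda>\<alpha>. t \<alpha> * d \<alpha>)"
  using F
proof (induction F rule: finite_induct)
  case empty
  show ?case
    using d by (intro exI[of _ "\<lambda>_. 1"]) simp
next
  case (insert \<gamma> F)
  then obtain t where t: "t \<beta> = 1" "\<forall>\<alpha>\<in>F. t \<alpha> = 0" "\<forall>\<alpha>. norm (t \<alpha>) \<le> 1" "vanishing_series \<Omega> (\<lambda>\<alpha>. t \<alpha> * d \<alpha>)"
    by auto
  have "\<beta> \<noteq> \<gamma>"
    using insert.prems by auto
  with \<Omega> t(4) obtain t' where t': "t' \<beta> = 1" "t' \<gamma> = 0" "\<And>\<alpha>. norm (t' \<alpha>) \<le> 1"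
    "vanishing_series \<Omega> (\<lambda>\<alpha>. t' \<alpha> * (t \<alpha> * d \<alpha>))"
    by (rule damp_vanishing_series) blast
  have "norm (t' \<alpha> * t \<alpha>) \<le> 1" for \<alpha>
    unfolding norm_mult using t(3) t'(3) by (intro mult_le_one) auto
  then show ?case
    using t t' by (intro exI[of _ "\<lambda>\<alpha>. t' \<alpha> * t \<alpha>"]) (simp add: mult.assoc)
qed

lemma vanishing_series_abs_summable:
  assumes "vanishing_series \<Omega> d" "z \<in> \<Omega>"
  shows "(\<lambda>\<alpha>. norm (d \<alpha> * monom \<alpha> z)) summable_on A"
  using assms unfolding vanishing_series_def
  by (metis has_sum_imp_summable summable_on_iff_abs_summable_on_complex summable_on_subset_banach
      subset_UNIV)

lemma norm_term_le_tail_of_vanishing_series: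
  assumes \<Omega>: "reinhardt \<Omega>" and d: "vanishing_series \<Omega> d" and a: "a \<in> \<Omega>" and F: "finite F" "\<beta> \<notin> F"
  shows "norm (d \<beta> * monom \<beta> a) \<le> (\<Sum>\<^sub>\<infinity>\<alpha>\<in>- insert \<beta> F. norm (d \<alpha> * monom \<alpha> a))"
proof -
  define c where "c \<alpha> = d \<alpha> * monom \<alpha> a" for \<alpha>
  obtain t where t: "t \<beta> = 1" "\<forall>\<alpha>\<in>F. t \<alpha> = 0" "\<forall>\<alpha>. norm (t \<alpha>) \<le> 1" "vanishing_series \<Omega> (\<lambda>\<alpha>. t \<alpha> * d \<alpha>)"
    using damp_vanishing_series_finite[OF \<Omega> d F] by blast
  have "((\<lambda>\<alpha>. t \<alpha> * c \<alpha>) has_sum (0 - (\<Sum>\<alpha>\<in>insert \<beta> F. t \<alpha> * c \<alpha>))) (- insert \<beta> F)"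
    using t(4) a F unfolding Compl_eq_Diff_UNIV
    by (intro has_sum_Diff has_sum_finite) (auto simp: vanishing_series_def c_def mult.assoc)
  then have "((\<lambda>\<alpha>. t \<alpha> * c \<alpha>) has_sum (- c \<beta>)) (- insert \<beta> F)"
    using F t(1,2) by (subst (asm) sum.insert) auto
  moreover have "((\<lambda>\<alpha>. norm (c \<alpha>)) has_sum (\<Sum>\<^sub>\<infinity>\<alpha>\<in>- insert \<beta> F. norm (c \<alpha>))) (- insert \<beta> F)"
    unfolding c_def by (rule has_sum_infsum[OF vanishing_series_abs_summable[OF d a]])
  moreover have "norm (t \<alpha> * c \<alpha>) \<le> norm (c \<alpha>)" for \<alpha>
    using t(3) by (simp add: norm_mult mult_left_le_one_le)
  ultimately have "norm (- c \<beta>) \<le> (\<Sum>\<^sub>\<infinity>\<alpha>\<in>- insert \<beta> F. norm (c \<alpha>))"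
    by (rule norm_infsum_le)
  then show ?thesis
    by (simp add: c_def)
qed

lemma vanishing_series_imp_eq_0:
  assumes "open \<Omega>" "\<Omega> \<noteq> {}" and \<Omega>: "reinhardt \<Omega>" and d: "vanishing_series \<Omega> d"
  shows "d \<beta> = 0"
proof -
  obtain a where a: "a \<in> \<Omega>" "\<And>j. a$j \<noteq> 0"
    using open_has_nonzero_coordinates assms(1,2) by blast
  define c where "c \<alpha> = norm (d \<alpha> * monom \<alpha> a)" for \<alpha>
  have c_summable: "c summable_on A" for A
    unfolding c_def[abs_def] by (rule vanishing_series_abs_summable[OF d a(1)])
  have "sum c F \<le> infsum c UNIV - 2 * c \<beta>" if F: "finite F" "F \<subseteq> - {\<beta>}" for F
  proof -
    have "c \<beta> \<le> infsum c (- insert \<beta> F)"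
      using norm_term_le_tail_of_vanishing_series[OF \<Omega> d a(1), of F \<beta>] F unfolding c_def[abs_def] by auto
    also have "\<dots> = infsum c UNIV - sum c (insert \<beta> F)"
      unfolding Compl_eq_Diff_UNIV using F by (subst infsum_Diff) (auto intro: c_summable)
    also have "sum c (insert \<beta> F) = c \<beta> + sum c F"
      using F by (intro sum.insert) auto
    finally show ?thesis
      by simp
  qed
  then have "infsum c (- {\<beta>}) \<le> infsum c UNIV - 2 * c \<beta>"
    by (intro infsum_le_finite_sums c_summable)
  also have "infsum c (- {\<beta>}) = infsum c UNIV - c \<beta>"
    unfolding Compl_eq_Diff_UNIV by (subst infsum_Diff) (auto intro: c_summable)
  finally have "c \<beta> \<le> 0"
    by simp
  then show ?thesis
    using a(2) by (simp add: c_def monom_def)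
qed

lemma laurent_series_unique:
  assumes \<Omega>: "open \<Omega>" "\<Omega> \<noteq> {}" "reinhardt \<Omega>"
    and c: "laurent_series \<Omega> f c" and c': "laurent_series \<Omega> f c'"
  shows "c = c'"
proof -
  have "((\<lambda>\<alpha>. c \<alpha> * monom \<alpha> z + - (c' \<alpha> * monom \<alpha> z)) has_sum (f z + - f z)) UNIV" if "z \<in> \<Omega>" for z
    using that c c' by (intro has_sum_add) (auto simp: laurent_series_def has_sum_uminus)
  then have "vanishing_series \<Omega> (\<lambda>\<alpha>. c \<alpha> - c' \<alpha>)"
    by (simp add: vanishing_series_def left_diff_distrib)
  then have "c \<beta> - c' \<beta> = 0" for \<beta>
    by (rule vanishing_series_imp_eq_0[OF \<Omega>])
  then show "c = c'"
    by auto
qed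

lemma laurent_seriesI:
  assumes sum: "\<And>z. z \<in> \<Omega> \<Longrightarrow> ((\<lambda>\<alpha>. c \<alpha> * monom \<alpha> z) has_sum f z) UNIV"
    and majorant: "\<And>K. compact K \<Longrightarrow> K \<subseteq> \<Omega> \<Longrightarrow>
      \<exists>h. h summable_on UNIV \<and> (\<forall>\<alpha>. \<forall>z\<in>K. norm (c \<alpha> * monom \<alpha> z) \<le> h \<alpha>)"
  shows "laurent_series \<Omega> f c"
  unfolding laurent_series_def
proof (intro conjI ballI allI impI)
  fix K assume K: "compact K \<and> K \<subseteq> \<Omega> \<and> K \<noteq> {}"
  then obtain a where a: "a \<in> K"
    by auto
  obtain h where h: "h summable_on UNIV" "\<And>\<alpha> z. z \<in> K \<Longrightarrow> norm (c \<alpha> * monom \<alpha> z) \<le> h \<alpha>"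
    using majorant[of K] K by auto
  show "(\<lambda>\<alpha>. SUP z\<in>K. norm (c \<alpha> * monom \<alpha> z)) summable_on UNIV"
  proof (rule summable_on_comparison_test[OF h(1)])
    show "(SUP z\<in>K. norm (c \<alpha> * monom \<alpha> z)) \<le> h \<alpha>" for \<alpha>
      using K by (intro cSUP_least h(2)) auto
    have "norm (c \<alpha> * monom \<alpha> a) \<le> (SUP z\<in>K. norm (c \<alpha> * monom \<alpha> z))" for \<alpha>
      by (intro cSUP_upper a bdd_aboveI2[OF h(2)])
    then show "0 \<le> (SUP z\<in>K. norm (c \<alpha> * monom \<alpha> z))" for \<alpha>
      by (rule order_trans[OF norm_ge_zero])
  qed
qed (rule sum)

section \<open>Weighted spaces on Reinhardt domains\<close>

lemma mem_Lp_space_iff: "f \<in> Lp_space \<Omega> wt p \<longleftrightarrow> Lp_integrable (wmeasure \<Omega> wt) p f"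
  by (auto simp: Lp_space_def Lp_integrable_def integrable_iff_bounded)

lemma Lpnorm_eq_Lp_seminorm:
  assumes "f \<in> Lp_space \<Omega> wt p"
  shows "Lpnorm \<Omega> wt p f = Lp_seminorm (wmeasure \<Omega> wt) p f"
proof -
  have [measurable]: "f \<in> borel_measurable (wmeasure \<Omega> wt)"
    using assms by (simp add: Lp_space_def)
  show ?thesis
    unfolding Lpnorm_def Lp_seminorm_def by (subst integral_eq_nn_integral) auto
qed

lemma holo_n_add:
  assumes "holo_n \<Omega> f" "holo_n \<Omega> g"
  shows "holo_n \<Omega> (\<lambda>z. f z + g z)"
  unfolding holo_n_def
proof
  fix z assume "z \<in> \<Omega>"
  then obtain L L' where "(f has_derivative L) (at z)" "\<forall>c v. L (c *s v) = c * L v"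
      "(g has_derivative L') (at z)" "\<forall>c v. L' (c *s v) = c * L' v"
    using assms unfolding holo_n_def by meson
  then show "\<exists>L. ((\<lambda>z. f z + g z) has_derivative L) (at z) \<and> (\<forall>c v. L (c *s v) = c * L v)"
    by (intro exI[of _ "\<lambda>v. L v + L' v"]) (auto intro: has_derivative_add simp: distrib_left)
qed

lemma holo_n_mult_left:
  assumes "holo_n \<Omega> f"
  shows "holo_n \<Omega> (\<lambda>z. c * f z)"
  unfolding holo_n_def
proof
  fix z assume "z \<in> \<Omega>"
  then obtain L where "(f has_derivative L) (at z)" "\<forall>c v. L (c *s v) = c * L v"
    using assms unfolding holo_n_def by blast
  then show "\<exists>L. ((\<lambda>z. c * f z) has_derivative L) (at z) \<and> (\<forall>c v. L (c *s v) = c * L v)"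
    by (intro exI[of _ "\<lambda>v. c * L v"]) (auto intro: has_derivative_mult_right)
qed

lemma holo_n_0: "holo_n \<Omega> (\<lambda>z. 0)"
  by (auto simp: holo_n_def intro!: exI[of _ "\<lambda>_. 0"])

lemma Ap_space_add:
  "f \<in> Ap_space \<Omega> wt p \<Longrightarrow> g \<in> Ap_space \<Omega> wt p \<Longrightarrow> 0 \<le> p \<Longrightarrow> (\<lambda>z. f z + g z) \<in> Ap_space \<Omega> wt p"
  unfolding Ap_space_def mem_Lp_space_iff by (auto intro: Lp_integrable_add holo_n_add)

lemma Ap_space_mult_left: "f \<in> Ap_space \<Omega> wt p \<Longrightarrow> (\<lambda>z. c * f z) \<in> Ap_space \<Omega> wt p"
  unfolding Ap_space_def mem_Lp_space_iff by (auto intro: Lp_integrable_mult_left holo_n_mult_left)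

lemma Ap_space_sum:
  assumes "\<And>i. i \<in> I \<Longrightarrow> f i \<in> Ap_space \<Omega> wt p" "0 \<le> p"
  shows "(\<lambda>z. \<Sum>i\<in>I. f i z) \<in> Ap_space \<Omega> wt p"
  using assms
proof (induction I rule: infinite_finite_induct)
  case (insert i I)
  then show ?case by (simp add: Ap_space_add)
qed (simp_all add: Ap_space_def mem_Lp_space_iff Lp_integrable_0 holo_n_0)

lemma Ap_space_diff:
  assumes "f \<in> Ap_space \<Omega> wt p" "g \<in> Ap_space \<Omega> wt p" "0 \<le> p"
  shows "(\<lambda>z. f z - g z) \<in> Ap_space \<Omega> wt p"
  using Ap_space_add[OF assms(1) Ap_space_mult_left[OF assms(2), of "-1"] assms(3)] by simp

lemma supnorm_le_iff: "supnorm \<alpha> \<le> int N \<longleftrightarrow> (\<forall>j. \<bar>\<alpha> j\<bar> \<le> int N)"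
  unfolding supnorm_def by (subst Max_le_iff) auto

lemma incseq_trunc_set: "incseq (trunc_set \<Omega> wt p)"
  by (auto simp: incseq_def trunc_set_def)

lemma finite_trunc_set: "finite (trunc_set \<Omega> wt p N)"
proof (rule finite_subset)
  show "trunc_set \<Omega> wt p N \<subseteq> (\<Pi>\<^sub>E j\<in>UNIV. {- int N..int N})"
    by (auto simp: trunc_set_def supnorm_le_iff abs_le_iff) (metis minus_le_iff)
qed (auto intro: finite_PiE)

lemma trunc_set_subset: "trunc_set \<Omega> wt p N \<subseteq> Sp_set \<Omega> wt p"
  by (auto simp: trunc_set_def)

lemma mem_trunc_set: "\<alpha> \<in> Sp_set \<Omega> wt p \<Longrightarrow> nat (supnorm \<alpha>) \<le> N \<Longrightarrow> \<alpha> \<in> trunc_set \<Omega> wt p N"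
  by (simp add: trunc_set_def nat_le_iff)

lemma UN_trunc_set: "(\<Union>N. trunc_set \<Omega> wt p N) = Sp_set \<Omega> wt p"
proof (intro equalityI UN_least trunc_set_subset subsetI)
  show "\<alpha> \<in> (\<Union>N. trunc_set \<Omega> wt p N)" if "\<alpha> \<in> Sp_set \<Omega> wt p" for \<alpha>
    using mem_trunc_set[OF that order_refl] by blast
qed

locale weighted_reinhardt =
  fixes \<Omega> :: "(complex^'n::finite) set" and wt :: "complex^'n \<Rightarrow> ennreal" and p :: real
  assumes open_\<Omega>: "open \<Omega>" and nonempty_\<Omega>: "\<Omega> \<noteq> {}" and reinhardt_\<Omega>: "reinhardt \<Omega>"
    and p_gt_1: "1 < p"
    and wt_measurable: "(\<lambda>z. wt z * indicator \<Omega> z) \<in> borel_measurable lebesgue"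
    and admissible_wt: "admissible \<Omega> wt p" and multi_radial_wt: "multi_radial \<Omega> wt"
begin

abbreviation "M \<equiv> wmeasure \<Omega> wt"
abbreviation "Lp \<equiv> Lp_space \<Omega> wt p"
abbreviation "Ap \<equiv> Ap_space \<Omega> wt p"
abbreviation "Sp \<equiv> Sp_set \<Omega> wt p"
abbreviation "trunc \<equiv> trunc_set \<Omega> wt p"
abbreviation "pnorm \<equiv> Lpnorm \<Omega> wt p"

definition q :: real where
  "q = p / (p - 1)"

definition dual_monom :: "('n \<Rightarrow> int) \<Rightarrow> complex^'n \<Rightarrow> complex" where
  "dual_monom \<alpha> w = duality_map p (monom \<alpha> w) / of_real (pnorm (monom \<alpha>) powr p)"

definition monom_coeff :: "('n \<Rightarrow> int) \<Rightarrow> (complex^'n \<Rightarrow> complex) \<Rightarrow> complex" where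
  "monom_coeff \<alpha> f = (\<integral>w. dual_monom \<alpha> w * f w \<partial>M)"

lemma p_nonneg: "0 \<le> p"
  using p_gt_1 by simp

lemma q_conjugate: "1 < q" "1/p + 1/q = 1" "1/q + 1/p = 1"
  using p_gt_1 by (auto simp: q_def field_simps)

lemma monom_measurable [measurable]: "monom \<alpha> \<in> borel_measurable M"
  using measurable_completion[of "monom \<alpha>" lborel borel] by (simp add: wmeasure_def)

lemma Lp_integrable_Lp: "f \<in> Lp \<Longrightarrow> Lp_integrable M p f"
  by (simp add: mem_Lp_space_iff)

lemma Lp_add: "f \<in> Lp \<Longrightarrow> g \<in> Lp \<Longrightarrow> (\<lambda>z. f z + g z) \<in> Lp"
  by (simp add: mem_Lp_space_iff Lp_integrable_add p_nonneg)

lemma Lp_mult_left: "f \<in> Lp \<Longrightarrow> (\<lambda>z. c * f z) \<in> Lp"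
  by (simp add: mem_Lp_space_iff Lp_integrable_mult_left)

lemma Lp_sum: "(\<And>i. i \<in> I \<Longrightarrow> f i \<in> Lp) \<Longrightarrow> (\<lambda>z. \<Sum>i\<in>I. f i z) \<in> Lp"
  by (simp add: mem_Lp_space_iff Lp_integrable_sum p_nonneg)

lemma Ap_imp_Lp: "f \<in> Ap \<Longrightarrow> f \<in> Lp"
  by (simp add: Ap_space_def)

lemma monom_Ap: "\<alpha> \<in> Sp \<Longrightarrow> monom \<alpha> \<in> Ap"
  by (simp add: Sp_set_def)

lemma monom_Lp: "\<alpha> \<in> Sp \<Longrightarrow> monom \<alpha> \<in> Lp"
  by (simp add: monom_Ap Ap_imp_Lp)

lemma pnorm_nonneg: "0 \<le> pnorm f"
  by (simp add: Lpnorm_def)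

lemma AE_in_\<Omega>: "AE z in M. z \<in> \<Omega>"
  unfolding wmeasure_def using wt_measurable by (subst AE_density) (auto simp: indicator_def)

lemma Ap_bounded_on_compact:
  assumes "compact K" "K \<subseteq> \<Omega>"
  obtains C where "0 \<le> C" "\<And>f z. f \<in> Ap \<Longrightarrow> z \<in> K \<Longrightarrow> norm (f z) \<le> C * pnorm f"
proof -
  obtain C where C: "\<forall>f\<in>Ap. \<forall>z\<in>K. norm (f z) \<le> C * pnorm f"
    using admissible_wt assms unfolding admissible_def by blast
  show thesis
  proof
    show "0 \<le> \<bar>C\<bar>"
      by simp
    fix f z assume "f \<in> Ap" "z \<in> K"
    with C have "norm (f z) \<le> C * pnorm f"
      by blast
    also have "\<dots> \<le> \<bar>C\<bar> * pnorm f"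
      by (intro mult_right_mono pnorm_nonneg abs_ge_self)
    finally show "norm (f z) \<le> \<bar>C\<bar> * pnorm f" .
  qed
qed

lemma Ap_bounded_at:
  assumes "z \<in> \<Omega>"
  obtains C where "\<And>f. f \<in> Ap \<Longrightarrow> norm (f z) \<le> C * pnorm f"
proof -
  have "compact {z}" "{z} \<subseteq> \<Omega>"
    using assms by auto
  then show thesis
    by (rule Ap_bounded_on_compact) (use that in blast)
qed

lemma pnorm_monom_pos:
  assumes "\<alpha> \<in> Sp"
  shows "0 < pnorm (monom \<alpha>)"
proof -
  obtain a where a: "a \<in> \<Omega>" "\<And>j. a$j \<noteq> 0"
    using open_has_nonzero_coordinates open_\<Omega> nonempty_\<Omega> by blast
  obtain C where "norm (monom \<alpha> a) \<le> C * pnorm (monom \<alpha>)"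
    using Ap_bounded_at[OF a(1)] monom_Ap[OF assms] by blast
  moreover have "0 < norm (monom \<alpha> a)"
    using a(2) by (simp add: monom_def)
  ultimately have "pnorm (monom \<alpha>) \<noteq> 0"
    by auto
  then show ?thesis
    using pnorm_nonneg[of "monom \<alpha>"] by simp
qed

lemma monom_majorant:
  assumes "compact K" "K \<subseteq> \<Omega>"
  obtains h where "h summable_on UNIV" "\<And>\<alpha>. 0 \<le> h \<alpha>"
    "\<And>\<alpha> z. \<alpha> \<in> Sp \<Longrightarrow> z \<in> K \<Longrightarrow> norm (monom \<alpha> z) \<le> h \<alpha> * pnorm (monom \<alpha>)"
proof -
  obtain K' s where K': "compact K'" "K' \<subseteq> \<Omega>" and s: "1 < s"
    and dilation_K': "\<And>\<alpha> z. z \<in> K \<Longrightarrow> dilation s \<alpha> * z \<in> K'"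
    using compact_neighbourhood_of_dilations[OF open_\<Omega> assms] by blast
  obtain C where C: "0 \<le> C" "\<And>f w. f \<in> Ap \<Longrightarrow> w \<in> K' \<Longrightarrow> norm (f w) \<le> C * pnorm f"
    using Ap_bounded_on_compact[OF K'] by blast
  define \<rho> where "\<rho> \<alpha> = (\<Prod>j\<in>UNIV. (1 / s) ^ nat \<bar>\<alpha> j\<bar>)" for \<alpha> :: "'n \<Rightarrow> int"
  have \<rho>: "0 \<le> \<rho> \<alpha>" for \<alpha>
    using s by (simp add: \<rho>_def prod_nonneg)
  show thesis
  proof
    show "(\<lambda>\<alpha>. \<rho> \<alpha> * C) summable_on UNIV"
      using s unfolding \<rho>_def by (intro summable_on_cmult_left summable_on_prod_geometric) auto
    show "0 \<le> \<rho> \<alpha> * C" for \<alpha>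
      using \<rho> C(1) by simp
    fix \<alpha> z assume "\<alpha> \<in> Sp" "z \<in> K"
    then have "\<rho> \<alpha> * norm (monom \<alpha> (dilation s \<alpha> * z)) \<le> \<rho> \<alpha> * (C * pnorm (monom \<alpha>))"
      by (intro mult_left_mono \<rho> C(2) monom_Ap dilation_K')
    then show "norm (monom \<alpha> z) \<le> \<rho> \<alpha> * C * pnorm (monom \<alpha>)"
      using s norm_monom_eq_dilation[of s \<alpha> z] by (simp add: \<rho>_def mult.assoc)
  qed
qed

lemma monom_orthogonal:
  assumes "\<alpha> \<noteq> \<beta>"
  shows "(\<integral>w. duality_map p (monom \<alpha> w) * monom \<beta> w \<partial>M) = 0"
proof -
  obtain u where u: "u \<in> torus" "monom \<beta> u = - monom \<alpha> u"
    using torus_separates_monoms[of \<beta> \<alpha>] assms by auto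
  let ?F = "\<lambda>w. duality_map p (monom \<alpha> w) * monom \<beta> w"
  have "cnj (monom \<alpha> u) * monom \<beta> u = - 1"
    using norm_monom_torus[OF u(1), of \<alpha>] by (simp add: u(2) complex_norm_square[symmetric] mult.commute)
  moreover have "?F (u * w) = cnj (monom \<alpha> u) * monom \<beta> u * ?F w" for w
    by (simp add: monom_mult duality_map_mult duality_map_unit norm_monom_torus[OF u(1)])
  ultimately have "?F (u * w) = - 1 * ?F w" for w
    by simp
  then show ?thesis
    by (intro integral_eq_0_if_equivariant[where T="(*) u" and c="-1"] measurable_wmeasure_mult_torus
        distr_wmeasure_mult_torus reinhardt_\<Omega> multi_radial_wt wt_measurable u(1)) auto
qed

lemma
  assumes "\<alpha> \<in> Sp"
  shows Lp_integrable_dual_monom: "Lp_integrable M q (dual_monom \<alpha>)"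
    and Lp_seminorm_dual_monom: "Lp_seminorm M q (dual_monom \<alpha>) = 1 / pnorm (monom \<alpha>)"
proof -
  let ?c = "1 / complex_of_real (pnorm (monom \<alpha>) powr p)"
  have dual: "dual_monom \<alpha> = (\<lambda>w. ?c * duality_map p (monom \<alpha> w))"
    by (simp add: dual_monom_def fun_eq_iff)
  note e = Lp_integrable_Lp[OF monom_Lp[OF assms]]
  show "Lp_integrable M q (dual_monom \<alpha>)"
    unfolding dual
    by (intro Lp_integrable_mult_left Lp_integrable_duality_map e p_gt_1 q_conjugate)
  have "Lp_seminorm M q (dual_monom \<alpha>) = norm ?c * Lp_seminorm M q (\<lambda>w. duality_map p (monom \<alpha> w))"
    unfolding dual using q_conjugate(1) by (intro Lp_seminorm_mult_left) simp
  also have "\<dots> = norm ?c * pnorm (monom \<alpha>) powr (p - 1)"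
    by (simp add: Lp_seminorm_duality_map[OF e p_gt_1 q_conjugate(2)]
        Lpnorm_eq_Lp_seminorm[OF monom_Lp[OF assms]])
  also have "\<dots> = 1 / pnorm (monom \<alpha>)"
    using pnorm_monom_pos[OF assms] by (simp add: powr_diff norm_divide)
  finally show "Lp_seminorm M q (dual_monom \<alpha>) = 1 / pnorm (monom \<alpha>)" .
qed

lemma integrable_dual_monom_mult: "f \<in> Lp \<Longrightarrow> \<alpha> \<in> Sp \<Longrightarrow> integrable M (\<lambda>w. dual_monom \<alpha> w * f w)"
  by (intro Holder_integrable[where p=q and q=p] Lp_integrable_dual_monom Lp_integrable_Lp q_conjugate)

lemma norm_monom_coeff_le:
  assumes f: "f \<in> Lp" and \<alpha>: "\<alpha> \<in> Sp"
  shows "norm (monom_coeff \<alpha> f) \<le> pnorm f / pnorm (monom \<alpha>)"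
proof -
  have "norm (monom_coeff \<alpha> f) \<le> (\<integral>w. norm (dual_monom \<alpha> w * f w) \<partial>M)"
    unfolding monom_coeff_def by (rule integral_norm_bound)
  also have "\<dots> \<le> Lp_seminorm M q (dual_monom \<alpha>) * Lp_seminorm M p f"
    by (intro Holder_inequality Lp_integrable_dual_monom Lp_integrable_Lp f \<alpha> q_conjugate)
  finally show ?thesis
    by (simp add: Lp_seminorm_dual_monom[OF \<alpha>] Lpnorm_eq_Lp_seminorm[OF f])
qed

lemma monom_coeff_add:
  "f \<in> Lp \<Longrightarrow> g \<in> Lp \<Longrightarrow> \<alpha> \<in> Sp \<Longrightarrow> monom_coeff \<alpha> (\<lambda>z. f z + g z) = monom_coeff \<alpha> f + monom_coeff \<alpha> g"
  by (simp add: monom_coeff_def distrib_left integrable_dual_monom_mult)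

lemma monom_coeff_mult_left: "monom_coeff \<alpha> (\<lambda>z. c * f z) = c * monom_coeff \<alpha> f"
  by (simp add: monom_coeff_def mult.left_commute)

lemma monom_coeff_diff:
  "f \<in> Lp \<Longrightarrow> g \<in> Lp \<Longrightarrow> \<alpha> \<in> Sp \<Longrightarrow> monom_coeff \<alpha> (\<lambda>z. f z - g z) = monom_coeff \<alpha> f - monom_coeff \<alpha> g"
  by (simp add: monom_coeff_def right_diff_distrib integrable_dual_monom_mult)

lemma monom_coeff_sum:
  "(\<And>i. i \<in> I \<Longrightarrow> f i \<in> Lp) \<Longrightarrow> \<alpha> \<in> Sp \<Longrightarrow> monom_coeff \<alpha> (\<lambda>z. \<Sum>i\<in>I. f i z) = (\<Sum>i\<in>I. monom_coeff \<alpha> (f i))"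
  by (simp add: monom_coeff_def sum_distrib_left integrable_dual_monom_mult)

lemma monom_coeff_cong:
  assumes "f \<in> Lp" "g \<in> Lp" "\<And>z. z \<in> \<Omega> \<Longrightarrow> f z = g z" "\<alpha> \<in> Sp"
  shows "monom_coeff \<alpha> f = monom_coeff \<alpha> g"
  unfolding monom_coeff_def using AE_in_\<Omega> assms(3)
  by (intro integral_cong_AE borel_measurable_integrable integrable_dual_monom_mult assms)
    (auto elim: eventually_mono)

lemma monom_coeff_monom:
  assumes "\<alpha> \<in> Sp"
  shows "monom_coeff \<alpha> (monom \<beta>) = (if \<alpha> = \<beta> then 1 else 0)"
proof -
  have "monom_coeff \<alpha> (monom \<beta>)
      = (\<integral>w. duality_map p (monom \<alpha> w) * monom \<beta> w \<partial>M) / of_real (pnorm (monom \<alpha>) powr p)"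
    by (simp add: monom_coeff_def dual_monom_def)
  moreover have "(\<integral>w. duality_map p (monom \<alpha> w) * monom \<alpha> w \<partial>M) = of_real (pnorm (monom \<alpha>) powr p)"
    using p_gt_1 Lpnorm_eq_Lp_seminorm[OF monom_Lp[OF assms]]
    by (simp add: mult.commute[of "duality_map _ _"] mult_duality_map Lp_seminorm_powr)
  ultimately show ?thesis
    using pnorm_monom_pos[OF assms] monom_orthogonal by auto
qed

lemma monom_coeff_laurent_polynomial:
  assumes "finite I" "I \<subseteq> Sp" "\<alpha> \<in> Sp"
  shows "monom_coeff \<alpha> (\<lambda>z. \<Sum>\<beta>\<in>I. c \<beta> * monom \<beta> z) = (if \<alpha> \<in> I then c \<alpha> else 0)"
proof -
  have "monom_coeff \<alpha> (\<lambda>z. \<Sum>\<beta>\<in>I. c \<beta> * monom \<beta> z) = (\<Sum>\<beta>\<in>I. c \<beta> * monom_coeff \<alpha> (monom \<beta>))"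
    using assms(2,3)
    by (subst monom_coeff_sum) (auto simp: monom_coeff_mult_left intro: Lp_mult_left monom_Lp)
  then show ?thesis
    using assms(1,3) by (simp add: monom_coeff_monom if_distrib cong: if_cong)
qed

lemma monom_coeff_series_majorant:
  assumes K: "compact K" "K \<subseteq> \<Omega>" and f: "f \<in> Lp"
  obtains h where "h summable_on UNIV" "\<And>\<alpha>. 0 \<le> h \<alpha>"
    "\<And>\<alpha> z. \<alpha> \<in> Sp \<Longrightarrow> z \<in> K \<Longrightarrow> norm (monom_coeff \<alpha> f * monom \<alpha> z) \<le> h \<alpha>"
proof -
  obtain h where h: "h summable_on UNIV" "\<And>\<alpha>. 0 \<le> h \<alpha>"
    "\<And>\<alpha> z. \<alpha> \<in> Sp \<Longrightarrow> z \<in> K \<Longrightarrow> norm (monom \<alpha> z) \<le> h \<alpha> * pnorm (monom \<alpha>)"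
    using monom_majorant[OF K] by blast
  show thesis
  proof
    show "(\<lambda>\<alpha>. pnorm f * h \<alpha>) summable_on UNIV" "0 \<le> pnorm f * h \<alpha>" for \<alpha>
      by (intro summable_on_cmult_right mult_nonneg_nonneg h(1,2) pnorm_nonneg)+
    fix \<alpha> z assume \<alpha>: "\<alpha> \<in> Sp" and z: "z \<in> K"
    have "norm (monom_coeff \<alpha> f) * norm (monom \<alpha> z) \<le> pnorm f / pnorm (monom \<alpha>) * (h \<alpha> * pnorm (monom \<alpha>))"
      by (intro mult_mono norm_monom_coeff_le f \<alpha> h(3) z divide_nonneg_nonneg pnorm_nonneg norm_ge_zero)
    then show "norm (monom_coeff \<alpha> f * monom \<alpha> z) \<le> pnorm f * h \<alpha>"
      using pnorm_monom_pos[OF \<alpha>] by (simp add: norm_mult)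
  qed
qed

lemma norm_preserving_extension_eq_monom_coeff:
  assumes \<alpha>: "\<alpha> \<in> Sp" and one: "\<Phi> (monom \<alpha>) = 1"
    and add: "\<And>f g. f \<in> Lp \<Longrightarrow> g \<in> Lp \<Longrightarrow> \<Phi> (\<lambda>z. f z + g z) = \<Phi> f + \<Phi> g"
    and mult: "\<And>f c. f \<in> Lp \<Longrightarrow> \<Phi> (\<lambda>z. c * f z) = c * \<Phi> f"
    and bound: "\<And>f. f \<in> Lp \<Longrightarrow> norm (\<Phi> f) \<le> 1 / pnorm (monom \<alpha>) * pnorm f"
    and f: "f \<in> Lp"
  shows "\<Phi> f = monom_coeff \<alpha> f"
proof -
  note e = monom_Lp[OF \<alpha>]
  note pnorm_e = Lpnorm_eq_Lp_seminorm[OF e]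
  have "\<Phi> f * of_real (Lp_seminorm M p (monom \<alpha>) powr p) = (\<integral>w. f w * duality_map p (monom \<alpha> w) \<partial>M)"
  proof (rule norming_functional_eq[OF p_gt_1])
    fix g h :: "complex^'n \<Rightarrow> complex"
    assume "Lp_integrable M p g"
    then have g: "g \<in> Lp"
      by (simp add: mem_Lp_space_iff)
    show "norm (\<Phi> g) * Lp_seminorm M p (monom \<alpha>) \<le> Lp_seminorm M p g"
      using bound[OF g] pnorm_monom_pos[OF \<alpha>]
      by (simp add: pnorm_e[symmetric] Lpnorm_eq_Lp_seminorm[OF g, symmetric] pos_le_divide_eq)
    show "\<Phi> (\<lambda>z. c * g z) = c * \<Phi> g" for c
      by (rule mult[OF g])
    show "\<Phi> (\<lambda>z. g z + h z) = \<Phi> g + \<Phi> h" if "Lp_integrable M p h"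
      using that by (intro add g) (simp add: mem_Lp_space_iff)
  qed (intro one Lp_integrable_Lp e f)+
  then have norming: "(\<integral>w. f w * duality_map p (monom \<alpha> w) \<partial>M) = \<Phi> f * of_real (pnorm (monom \<alpha>) powr p)"
    by (simp only: pnorm_e)
  have "monom_coeff \<alpha> f = (\<integral>w. f w * duality_map p (monom \<alpha> w) \<partial>M) / of_real (pnorm (monom \<alpha>) powr p)"
    by (simp add: monom_coeff_def dual_monom_def mult.commute)
  then show ?thesis
    using pnorm_monom_pos[OF \<alpha>] unfolding norming by simp
qed

end

section \<open>The monomial basis projection\<close>

locale monomial_basis_projection = weighted_reinhardt \<Omega> wt p
  for \<Omega> :: "(complex^'n::finite) set" and wt and p +
  fixes P :: "(complex^'n \<Rightarrow> complex) \<Rightarrow> (complex^'n \<Rightarrow> complex)"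
  assumes MBP: "is_MBP \<Omega> wt p P"
begin

abbreviation ext :: "('n \<Rightarrow> int) \<Rightarrow> (complex^'n \<Rightarrow> complex) \<Rightarrow> complex" where
  "ext \<equiv> ext_coeff \<Omega> wt p"

definition remainder :: "nat \<Rightarrow> (complex^'n \<Rightarrow> complex) \<Rightarrow> complex^'n \<Rightarrow> complex" where
  "remainder N f z = P f z - (\<Sum>\<alpha>\<in>trunc N. ext \<alpha> f * monom \<alpha> z)"

lemma P_Ap: "f \<in> Lp \<Longrightarrow> P f \<in> Ap"
  using MBP by (simp add: is_MBP_def)

lemma P_reproduces: "g \<in> Ap \<Longrightarrow> z \<in> \<Omega> \<Longrightarrow> P g z = g z"
  using MBP by (simp add: is_MBP_def)

lemma pnorm_remainder_tendsto_0: "f \<in> Lp \<Longrightarrow> (\<lambda>N. pnorm (remainder N f)) \<longlonglongrightarrow> 0"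
  using MBP by (simp add: is_MBP_def remainder_def[abs_def])

lemma remainder_Ap: "f \<in> Lp \<Longrightarrow> remainder N f \<in> Ap"
  using trunc_set_subset[of \<Omega> wt p N] unfolding remainder_def[abs_def]
  by (intro Ap_space_diff P_Ap Ap_space_sum Ap_space_mult_left monom_Ap p_nonneg) auto

lemma tendsto_sum_ext_P:
  assumes f: "f \<in> Lp" and z: "z \<in> \<Omega>"
  shows "(\<lambda>N. \<Sum>\<alpha>\<in>trunc N. ext \<alpha> f * monom \<alpha> z) \<longlonglongrightarrow> P f z"
proof -
  obtain C where C: "\<And>g. g \<in> Ap \<Longrightarrow> norm (g z) \<le> C * pnorm g"
    using Ap_bounded_at[OF z] by blast
  have "(\<lambda>N. C * pnorm (remainder N f)) \<longlonglongrightarrow> 0"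
    by (intro tendsto_mult_right_zero pnorm_remainder_tendsto_0 f)
  then have "(\<lambda>N. remainder N f z) \<longlonglongrightarrow> 0"
    by (rule Lim_null_comparison[rotated]) (simp add: C remainder_Ap f)
  then have "(\<lambda>N. P f z - remainder N f z) \<longlonglongrightarrow> P f z - 0"
    by (intro tendsto_intros)
  then show ?thesis
    by (simp add: remainder_def)
qed

lemma ext_eq_monom_coeff_P:
  assumes f: "f \<in> Lp" and \<alpha>: "\<alpha> \<in> Sp"
  shows "ext \<alpha> f = monom_coeff \<alpha> (P f)"
proof -
  have "monom_coeff \<alpha> (remainder N f) = monom_coeff \<alpha> (P f) - ext \<alpha> f" if "nat (supnorm \<alpha>) \<le> N" for N
  proof -
    have "(\<lambda>z. \<Sum>\<beta>\<in>trunc N. ext \<beta> f * monom \<beta> z) \<in> Lp"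
      using trunc_set_subset[of \<Omega> wt p N] by (intro Lp_sum Lp_mult_left monom_Lp) auto
    then have "monom_coeff \<alpha> (remainder N f)
        = monom_coeff \<alpha> (P f) - monom_coeff \<alpha> (\<lambda>z. \<Sum>\<beta>\<in>trunc N. ext \<beta> f * monom \<beta> z)"
      unfolding remainder_def[abs_def] by (rule monom_coeff_diff[OF Ap_imp_Lp[OF P_Ap[OF f]] _ \<alpha>])
    then show ?thesis
      using mem_trunc_set[OF \<alpha> that]
      by (simp add: monom_coeff_laurent_polynomial finite_trunc_set trunc_set_subset \<alpha>)
  qed
  moreover have "(\<lambda>N. monom_coeff \<alpha> (remainder N f)) \<longlonglongrightarrow> 0"
  proof (rule Lim_null_comparison)
    show "\<forall>\<^sub>F N in sequentially. norm (monom_coeff \<alpha> (remainder N f))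
        \<le> pnorm (remainder N f) / pnorm (monom \<alpha>)"
      by (simp add: norm_monom_coeff_le Ap_imp_Lp remainder_Ap f \<alpha>)
    show "(\<lambda>N. pnorm (remainder N f) / pnorm (monom \<alpha>)) \<longlonglongrightarrow> 0"
      by (intro tendsto_divide_zero pnorm_remainder_tendsto_0 f)
  qed
  ultimately have "(\<lambda>N::nat. monom_coeff \<alpha> (P f) - ext \<alpha> f) \<longlonglongrightarrow> 0"
    by (rule Lim_transform_eventually[OF _ eventually_sequentiallyI[of "nat (supnorm \<alpha>)"], rotated])
  then show ?thesis
    by (simp add: LIMSEQ_const_iff)
qed

lemma ext_Ap:
  assumes "g \<in> Ap" "\<alpha> \<in> Sp"
  shows "ext \<alpha> g = monom_coeff \<alpha> g"
  unfolding ext_eq_monom_coeff_P[OF Ap_imp_Lp[OF assms(1)] assms(2)]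
  by (intro monom_coeff_cong Ap_imp_Lp P_Ap P_reproduces assms)

lemma tendsto_sum_monom_coeff_P:
  assumes f: "f \<in> Lp" and z: "z \<in> \<Omega>" and ext: "\<And>\<alpha>. \<alpha> \<in> Sp \<Longrightarrow> ext \<alpha> f = monom_coeff \<alpha> f"
  shows "(\<lambda>N. \<Sum>\<alpha>\<in>trunc N. monom_coeff \<alpha> f * monom \<alpha> z) \<longlonglongrightarrow> P f z"
proof -
  have "(\<Sum>\<alpha>\<in>trunc N. ext \<alpha> f * monom \<alpha> z) = (\<Sum>\<alpha>\<in>trunc N. monom_coeff \<alpha> f * monom \<alpha> z)" for N
    using trunc_set_subset[of \<Omega> wt p N] by (intro sum.cong) (auto simp: ext)
  then show ?thesis
    using tendsto_sum_ext_P[OF f z] by simp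
qed

lemma monom_coeff_series_has_sum:
  assumes g: "g \<in> Ap" and z: "z \<in> \<Omega>"
  shows "((\<lambda>\<alpha>. monom_coeff \<alpha> g * monom \<alpha> z) has_sum g z) Sp"
proof -
  have "compact {z}" "{z} \<subseteq> \<Omega>"
    using z by auto
  then obtain h where h: "h summable_on UNIV" "\<And>\<alpha>. 0 \<le> h \<alpha>"
    "\<And>\<alpha> w. \<alpha> \<in> Sp \<Longrightarrow> w \<in> {z} \<Longrightarrow> norm (monom_coeff \<alpha> g * monom \<alpha> w) \<le> h \<alpha>"
    using Ap_imp_Lp[OF g] by (rule monom_coeff_series_majorant) blast
  have "h summable_on Sp"
    using h(1) by (rule summable_on_subset_banach) simp
  then have "(\<lambda>\<alpha>. norm (monom_coeff \<alpha> g * monom \<alpha> z)) summable_on Sp"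
    by (rule summable_on_comparison_test) (use h(2,3) in auto)
  then have "(\<lambda>\<alpha>. monom_coeff \<alpha> g * monom \<alpha> z) summable_on Sp"
    by (rule abs_summable_summable)
  then obtain s where s: "((\<lambda>\<alpha>. monom_coeff \<alpha> g * monom \<alpha> z) has_sum s) Sp"
    by (auto simp: summable_on_def)
  then have "(\<lambda>N. \<Sum>\<alpha>\<in>trunc N. monom_coeff \<alpha> g * monom \<alpha> z) \<longlonglongrightarrow> s"
    by (intro has_sum_imp_tendsto_sums_incseq incseq_trunc_set finite_trunc_set) (simp add: UN_trunc_set)
  moreover have "(\<lambda>N. \<Sum>\<alpha>\<in>trunc N. monom_coeff \<alpha> g * monom \<alpha> z) \<longlonglongrightarrow> g z"
    using tendsto_sum_monom_coeff_P[OF Ap_imp_Lp[OF g] z ext_Ap[OF g]] by (simp add: P_reproduces[OF g z])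
  ultimately have "s = g z"
    by (rule LIMSEQ_unique)
  with s show ?thesis
    by simp
qed

lemma laurent_series_monom_coeff:
  assumes g: "g \<in> Ap"
  shows "laurent_series \<Omega> g (\<lambda>\<alpha>. if \<alpha> \<in> Sp then monom_coeff \<alpha> g else 0)"
proof (rule laurent_seriesI)
  show "((\<lambda>\<alpha>. (if \<alpha> \<in> Sp then monom_coeff \<alpha> g else 0) * monom \<alpha> z) has_sum g z) UNIV" if "z \<in> \<Omega>" for z
    using monom_coeff_series_has_sum[OF g that]
    by (rule has_sum_cong_neutral[THEN iffD1, rotated -1]) auto
  show "\<exists>h. h summable_on UNIV \<and> (\<forall>\<alpha>. \<forall>z\<in>K. norm ((if \<alpha> \<in> Sp then monom_coeff \<alpha> g else 0) * monom \<alpha> z) \<le> h \<alpha>)"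
    if K: "compact K" "K \<subseteq> \<Omega>" for K
  proof -
    obtain h where h: "h summable_on UNIV" "\<And>\<alpha>. 0 \<le> h \<alpha>"
      "\<And>\<alpha> z. \<alpha> \<in> Sp \<Longrightarrow> z \<in> K \<Longrightarrow> norm (monom_coeff \<alpha> g * monom \<alpha> z) \<le> h \<alpha>"
      using K Ap_imp_Lp[OF g] by (rule monom_coeff_series_majorant) blast
    then show ?thesis
      by (intro exI[of _ h]) auto
  qed
qed

lemma laurent_coeff_Ap:
  assumes g: "g \<in> Ap" and \<alpha>: "\<alpha> \<in> Sp"
  shows "laurent_coeff \<Omega> \<alpha> g = monom_coeff \<alpha> g"
proof -
  have "(THE c. laurent_series \<Omega> g c) = (\<lambda>\<alpha>. if \<alpha> \<in> Sp then monom_coeff \<alpha> g else 0)"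
    using laurent_series_monom_coeff[OF g] laurent_series_unique[OF open_\<Omega> nonempty_\<Omega> reinhardt_\<Omega>]
    by (intro the_equality)
  then show ?thesis
    using \<alpha> by (simp add: laurent_coeff_def)
qed

lemma coeff_opnorm_eq:
  assumes \<alpha>: "\<alpha> \<in> Sp"
  shows "coeff_opnorm \<Omega> wt p \<alpha> = 1 / pnorm (monom \<alpha>)"
  unfolding coeff_opnorm_def
proof (rule cSup_eq_maximum)
  let ?Q = "{norm (laurent_coeff \<Omega> \<alpha> f) / pnorm f |f. f \<in> Ap \<and> 0 < pnorm f}"
  have "1 / pnorm (monom \<alpha>) = norm (laurent_coeff \<Omega> \<alpha> (monom \<alpha>)) / pnorm (monom \<alpha>)"
    by (simp add: laurent_coeff_Ap monom_Ap \<alpha> monom_coeff_monom)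
  then show "1 / pnorm (monom \<alpha>) \<in> ?Q \<union> {0}"
    using monom_Ap[OF \<alpha>] pnorm_monom_pos[OF \<alpha>] by blast
  have "norm (laurent_coeff \<Omega> \<alpha> f) / pnorm f \<le> 1 / pnorm (monom \<alpha>)" if "f \<in> Ap" "0 < pnorm f" for f
    using norm_monom_coeff_le[OF Ap_imp_Lp[OF that(1)] \<alpha>] that
    by (simp add: laurent_coeff_Ap \<alpha> pos_divide_le_eq)
  then show "x \<le> 1 / pnorm (monom \<alpha>)" if "x \<in> ?Q \<union> {0}" for x
    using that pnorm_nonneg by auto
qed

lemma ext_eq_monom_coeff:
  assumes \<alpha>: "\<alpha> \<in> Sp" and f: "f \<in> Lp"
  shows "ext \<alpha> f = monom_coeff \<alpha> f"
proof -
  have "ext \<alpha> = (\<lambda>f. if f \<in> Lp then monom_coeff \<alpha> f else 0)"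
    unfolding ext_coeff_def coeff_opnorm_eq[OF \<alpha>]
  proof (rule the_equality, goal_cases exists unique)
    case exists
    show ?case
      using norm_monom_coeff_le[OF _ \<alpha>]
      by (auto simp: Ap_imp_Lp laurent_coeff_Ap \<alpha> Lp_add Lp_mult_left monom_coeff_add monom_coeff_mult_left)
  next
    case (unique \<Phi>)
    have "\<Phi> (monom \<alpha>) = 1"
      using unique monom_Ap[OF \<alpha>] by (simp add: laurent_coeff_Ap \<alpha> monom_coeff_monom)
    then have "\<Phi> f = monom_coeff \<alpha> f" if "f \<in> Lp" for f
      using norm_preserving_extension_eq_monom_coeff[OF \<alpha>, of \<Phi>] unique that by blast
    then show ?case
      using unique by auto
  qed
  then show ?thesis
    using f by simp
qed

end

section \<open>The monomial basis kernel\<close>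

context weighted_reinhardt
begin

lemma mb_kernel_eq: "mb_kernel \<Omega> wt p z w = lim (\<lambda>N. \<Sum>\<alpha>\<in>trunc N. monom \<alpha> z * dual_monom \<alpha> w)"
  by (simp add: mb_kernel_def dual_monom_def duality_map_def mult.assoc)

lemma
  assumes "\<alpha> \<in> trunc N"
  shows Lp_integrable_kernel_term: "Lp_integrable M q (\<lambda>w. monom \<alpha> z * dual_monom \<alpha> w)"
    and Lp_seminorm_kernel_term:
      "Lp_seminorm M q (\<lambda>w. monom \<alpha> z * dual_monom \<alpha> w) = norm (monom \<alpha> z) / pnorm (monom \<alpha>)"
proof -
  have \<alpha>: "\<alpha> \<in> Sp"
    using assms trunc_set_subset by blast
  show "Lp_integrable M q (\<lambda>w. monom \<alpha> z * dual_monom \<alpha> w)"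
    by (intro Lp_integrable_mult_left Lp_integrable_dual_monom \<alpha>)
  show "Lp_seminorm M q (\<lambda>w. monom \<alpha> z * dual_monom \<alpha> w) = norm (monom \<alpha> z) / pnorm (monom \<alpha>)"
    using q_conjugate(1) by (simp add: Lp_seminorm_mult_left Lp_seminorm_dual_monom \<alpha>)
qed

lemma sum_Lp_seminorm_kernel_terms_bounded:
  assumes z: "z \<in> \<Omega>"
  obtains B where "\<And>N. (\<Sum>\<alpha>\<in>trunc N. Lp_seminorm M q (\<lambda>w. monom \<alpha> z * dual_monom \<alpha> w)) \<le> B"
proof -
  have "compact {z}" "{z} \<subseteq> \<Omega>"
    using z by auto
  then obtain h where h: "h summable_on UNIV" "\<And>\<alpha>. 0 \<le> h \<alpha>"
    "\<And>\<alpha> w. \<alpha> \<in> Sp \<Longrightarrow> w \<in> {z} \<Longrightarrow> norm (monom \<alpha> w) \<le> h \<alpha> * pnorm (monom \<alpha>)"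
    by (rule monom_majorant) blast
  have "(\<Sum>\<alpha>\<in>trunc N. Lp_seminorm M q (\<lambda>w. monom \<alpha> z * dual_monom \<alpha> w)) \<le> infsum h UNIV" for N
  proof -
    have "norm (monom \<alpha> z) / pnorm (monom \<alpha>) \<le> h \<alpha>" if "\<alpha> \<in> trunc N" for \<alpha>
    proof -
      have \<alpha>: "\<alpha> \<in> Sp"
        using that trunc_set_subset by blast
      then show ?thesis
        using h(3)[OF \<alpha>, of z] pnorm_monom_pos[OF \<alpha>] by (simp add: pos_divide_le_eq)
    qed
    then have "(\<Sum>\<alpha>\<in>trunc N. Lp_seminorm M q (\<lambda>w. monom \<alpha> z * dual_monom \<alpha> w)) \<le> (\<Sum>\<alpha>\<in>trunc N. h \<alpha>)"
      by (intro sum_mono) (simp add: Lp_seminorm_kernel_term)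
    also have "\<dots> \<le> infsum h UNIV"
      using h(2) by (intro finite_sum_le_infsum h(1) finite_trunc_set) auto
    finally show ?thesis .
  qed
  then show thesis
    by (rule that)
qed

lemma mb_kernel_Lq:
  assumes z: "z \<in> \<Omega>"
  shows "mb_kernel \<Omega> wt p z \<in> Lp_space \<Omega> wt q"
proof -
  obtain B where B: "\<And>N. (\<Sum>\<alpha>\<in>trunc N. Lp_seminorm M q (\<lambda>w. monom \<alpha> z * dual_monom \<alpha> w)) \<le> B"
    using sum_Lp_seminorm_kernel_terms_bounded[OF z] by blast
  show ?thesis
    unfolding mem_Lp_space_iff mb_kernel_eq[abs_def]
    by (rule Lp_integrable_series[OF q_conjugate(1) incseq_trunc_set finite_trunc_set
          Lp_integrable_kernel_term B])
qed

lemma tendsto_integral_mb_kernel: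
  assumes z: "z \<in> \<Omega>" and f: "f \<in> Lp"
  shows "(\<lambda>N. \<Sum>\<alpha>\<in>trunc N. monom_coeff \<alpha> f * monom \<alpha> z) \<longlonglongrightarrow> (\<integral>w. mb_kernel \<Omega> wt p z w * f w \<partial>M)"
proof -
  obtain B where B: "\<And>N. (\<Sum>\<alpha>\<in>trunc N. Lp_seminorm M q (\<lambda>w. monom \<alpha> z * dual_monom \<alpha> w)) \<le> B"
    using sum_Lp_seminorm_kernel_terms_bounded[OF z] by blast
  have "(\<lambda>N. \<Sum>\<alpha>\<in>trunc N. \<integral>w. monom \<alpha> z * dual_monom \<alpha> w * f w \<partial>M)
      \<longlonglongrightarrow> (\<integral>w. mb_kernel \<Omega> wt p z w * f w \<partial>M)"
    unfolding mb_kernel_eq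
    by (rule tendsto_integral_Lp_series[OF q_conjugate(1) incseq_trunc_set finite_trunc_set
          Lp_integrable_kernel_term B Lp_integrable_Lp[OF f] q_conjugate(3)])
  moreover have "(\<integral>w. monom \<alpha> z * dual_monom \<alpha> w * f w \<partial>M) = monom_coeff \<alpha> f * monom \<alpha> z" for \<alpha>
    by (simp add: monom_coeff_def mult.assoc mult.commute[of _ "monom \<alpha> z"])
  ultimately show ?thesis
    by simp
qed

end

lemma (in monomial_basis_projection) P_eq_integral_mb_kernel:
  assumes f: "f \<in> Lp" and z: "z \<in> \<Omega>"
  shows "P f z = (\<integral>w. mb_kernel \<Omega> wt p z w * f w \<partial>M)"
  using tendsto_sum_monom_coeff_P[OF f z ext_eq_monom_coeff[OF _ f]] tendsto_integral_mb_kernel[OF z f]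
  by (rule LIMSEQ_unique)

theorem theorem3p5:
  fixes \<Omega> :: "(complex^'n::finite) set"
    and wt :: "complex^'n \<Rightarrow> ennreal"
    and p :: real
    and P :: "(complex^'n \<Rightarrow> complex) \<Rightarrow> (complex^'n \<Rightarrow> complex)"
  assumes "cdomain \<Omega>" and "bounded \<Omega>" and "pseudoconvex \<Omega>" and "reinhardt \<Omega>"
    and "1 < p"
    and "(\<lambda>z. wt z * indicator \<Omega> z) \<in> borel_measurable lebesgue"
    and "AE z in lebesgue. z \<in> \<Omega> \<longrightarrow> wt z > 0"
    and "admissible \<Omega> wt p" and "multi_radial \<Omega> wt"
    and "is_MBP \<Omega> wt p P"
  shows "(\<forall>f\<in>Lp_space \<Omega> wt p. \<forall>z\<in>\<Omega>.
            P f z = (\<integral>w. mb_kernel \<Omega> wt p z w * f w \<partial>wmeasure \<Omega> wt))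
       \<and> (\<forall>z\<in>\<Omega>. mb_kernel \<Omega> wt p z \<in> Lp_space \<Omega> wt (p / (p - 1)))"
proof -
  interpret monomial_basis_projection \<Omega> wt p P
    by unfold_locales (use assms in \<open>auto simp: cdomain_def\<close>)
  show ?thesis
    using P_eq_integral_mb_kernel mb_kernel_Lq unfolding q_def by blast
qed

end
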